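(* Let $\pi(x)$ denote the number of primes $p\le x$, for real $x\ge 0$. Then $\pi(x)\sim \dfrac{x}{\log x}$ as $x\to\infty$; equivalently, $$\lim_{x\to\infty}\frac{\pi(x)\log x}{x}=1.$$
   Context: The notation $f(x)\sim g(x)$ means $\lim_{x\to\infty} f(x)/g(x)=1$. $\log$ is the natural logarithm. *)

theory Defs
  imports
    Complex_Main
    "HOL-Computational_Algebra.Primes"
    "HOL-Library.Landau_Symbols"
begin

definition prime_count :: "real \<Rightarrow> nat" where
  "prime_count x = card {p :: nat. prime p \<and> real p \<le> x}"

end

theory Submission
  imports
    Defs
    "HOL-Complex_Analysis.Complex_Analysis"
    "HOL-Number_Theory.Prime_Powers"
    "HOL-Real_Asymp.Real_Asymp"
begin

text \<open>
  Let \<open>\<psi>(n)\<close> be the partial sums of the von Mangoldt function. The Dirichlet convolution of the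
  latter with \<open>1\<close> is the logarithm, so its Dirichlet series is \<open>-\<zeta>'/\<zeta>\<close>, and the inequality
  \<open>3 + 4 cos t + cos 2t \<ge> 0\<close> keeps \<open>(s - 1) \<zeta>(s)\<close> from vanishing on \<open>Re s \<ge> 1\<close>. Hence the series with
  coefficients \<open>\<Lambda>(n) - 1\<close> extends analytically to this closed half-plane. After summation by parts
  the same holds for the coefficients \<open>(\<psi>(n) - n)/n\<close>, which are bounded by Chebyshev's estimate, so
  that Newman's contour argument applies: \<open>\<Sum> (\<psi>(n) - n)/n\<^sup>2\<close> converges. As \<open>\<psi>\<close> is monotone,
  this forces \<open>\<psi>(n) \<sim> n\<close>, from which \<open>\<pi>(x) \<sim> x / ln x\<close> follows by elementary estimates.
\<close>

section \<open>Newman's Tauberian theorem for Dirichlet series\<close>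

text \<open>Newman's argument needs bounded coefficients, and \<Lambda>(n) - 1 is unbounded. It is
  therefore run on (\<psi>(n) - n)/n, at the price of a correction series left behind by the
  summation by parts. That series is harmless for the same reason that (s - 1) \<zeta>(s) continues
  past the line Re s = 1: both are sums of second-order Taylor remainders of powers of n, which gain
  a factor 1/n and so converge one unit further to the left. The single estimate
  \<open>norm_powr_Suc_diff_le\<close> serves both. The order of the poles matters too: \<Lambda>
  and 1 have Dirichlet series with the same simple pole at 1, so only their difference can be
  continued to the whole closed half-plane. Convergence of the final series is used through Cauchy's
  criterion: a deviation of \<psi>(N) from N persists, by monotonicity, over a block of indices of
  length proportional to N, and such a block would contribute an amount that does not shrink with
  N.\<close>

definition right_arc :: "real \<Rightarrow> real \<Rightarrow> complex" where
  "right_arc R = part_circlepath 0 R (-(pi/2)) (pi/2)"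

definition left_arc :: "real \<Rightarrow> real \<Rightarrow> complex" where
  "left_arc R = part_circlepath 0 R (pi/2) (3*pi/2)"

text \<open>The term z/R^2 leaves the residue 1 at 0 unchanged. On the circle of radius R it is the
  conjugate of 1/z, so there the kernel is real and vanishes exactly at \<plusminus>iR, where the
  two arcs meet.\<close>

abbreviation newman_kernel :: "real \<Rightarrow> complex \<Rightarrow> complex" where
  "newman_kernel R z \<equiv> 1/z + z / of_real R ^ 2"

lemma valid_path_arcs [simp]: "valid_path (right_arc R)" "valid_path (left_arc R)"
  by (simp_all add: right_arc_def left_arc_def)

lemma arc_endpoints [simp]:
  "pathstart (right_arc R) = - (\<i> * R)" "pathfinish (right_arc R) = \<i> * R"
  "pathstart (left_arc R) = \<i> * R" "pathfinish (left_arc R) = - (\<i> * R)"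
proof -
  have 1: "exp (\<i> * of_real (pi/2)) = \<i>" "exp (\<i> * of_real (-(pi/2))) = -\<i>"
    unfolding cis_conv_exp [symmetric] by (simp_all add: complex_eq_iff)
  have "cis (3*pi/2) = -\<i>"
    using cis_mult[of pi "pi/2"] by (simp add: algebra_simps)
  hence 2: "exp (\<i> * of_real (3*pi/2)) = -\<i>" unfolding cis_conv_exp .
  show "pathstart (right_arc R) = - (\<i> * R)" "pathfinish (right_arc R) = \<i> * R"
    "pathstart (left_arc R) = \<i> * R" "pathfinish (left_arc R) = - (\<i> * R)"
    unfolding right_arc_def left_arc_def pathstart_part_circlepath pathfinish_part_circlepath
      linepath_0' linepath_1' 1 2 by simp_all
qed

lemma right_arc_image:
  assumes "R > 0" "z \<in> path_image (right_arc R)"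
  shows "norm z = R" "Re z \<ge> 0"
proof -
  obtain t where t: "z = of_real R * exp (\<i> * of_real t)" "t \<in> {-(pi/2)..pi/2}"
  proof -
    have "z \<in> (\<lambda>t. of_real R * exp (\<i> * of_real t)) ` {-(pi/2)..pi/2}"
      using assms(2) by (simp add: right_arc_def path_image_part_circlepath' closed_segment_eq_real_ivl cis_conv_exp)
    thus ?thesis using that by blast
  qed
  show "norm z = R" using t assms(1) by (simp add: norm_mult)
  show "Re z \<ge> 0" using t assms(1) by (auto simp: Re_exp intro!: mult_nonneg_nonneg cos_ge_zero)
qed

lemma left_arc_image:
  assumes "R > 0" "z \<in> path_image (left_arc R)"
  shows "norm z = R" "Re z \<le> 0"
proof -
  obtain t where t: "z = of_real R * exp (\<i> * of_real t)" "t \<in> {pi/2..3*pi/2}"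
  proof -
    have "z \<in> (\<lambda>t. of_real R * exp (\<i> * of_real t)) ` {pi/2..3*pi/2}"
      using assms(2) by (simp add: left_arc_def path_image_part_circlepath' closed_segment_eq_real_ivl cis_conv_exp)
    thus ?thesis using that by blast
  qed
  show "norm z = R" using t assms(1) by (simp add: norm_mult)
  have "cos (t - pi) \<ge> 0" using t by (intro cos_ge_zero) auto
  hence "cos t \<le> 0" by (simp add: cos_diff)
  thus "Re z \<le> 0" using t assms(1) by (auto simp: Re_exp mult_nonneg_nonpos)
qed

text \<open>Integrating 1/z with the primitive \<open>Ln z\<close> on the right and
  \<open>Ln (-z)\<close> on the left avoids both branch cuts; each half contributes i times pi.
  Since \<gamma> is any path in the left half-plane without 0, the lemma covers the left arc as well
  as the path of segments.\<close>

lemma winding_number_right_arc_join: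
  assumes R: "R > 0" and \<gamma>: "valid_path \<gamma>" "path_image \<gamma> \<subseteq> {z. Re z \<le> 0} - {0}"
    "pathstart \<gamma> = \<i> * R" "pathfinish \<gamma> = - (\<i> * R)"
  shows "winding_number (right_arc R +++ \<gamma>) 0 = 1"
proof -
  have LnR: "Ln (\<i> * R) - Ln (- (\<i> * R)) = \<i> * pi"
    using R Ln_times_of_real[of R \<i>] Ln_times_of_real[of R "-\<i>"]
    by (simp add: mult.commute)
  have right: "path_image (right_arc R) \<subseteq> {z. Re z \<ge> 0} - {0}"
    using right_arc_image[OF R] R by force
  have "((\<lambda>z. 1/z) has_contour_integral Ln (pathfinish (right_arc R)) - Ln (pathstart (right_arc R))) (right_arc R)"
  proof (rule contour_integral_primitive[OF _ _ right])
    fix z :: complex assume "z \<in> {z. Re z \<ge> 0} - {0}"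
    hence "z \<notin> \<real>\<^sub>\<le>\<^sub>0" by (auto simp: complex_nonpos_Reals_iff complex_eq_iff)
    thus "(Ln has_field_derivative 1 / z) (at z within {z. 0 \<le> Re z} - {0})"
      by (auto intro!: derivative_eq_intros simp: inverse_eq_divide)
  qed auto
  hence 1: "((\<lambda>z. 1/z) has_contour_integral \<i> * pi) (right_arc R)"
    using LnR by (simp add: arc_endpoints)
  have "((\<lambda>z. 1/z) has_contour_integral Ln (- pathfinish \<gamma>) - Ln (- pathstart \<gamma>)) \<gamma>"
  proof (rule contour_integral_primitive[OF _ _ \<gamma>(2)])
    fix z :: complex assume "z \<in> {z. Re z \<le> 0} - {0}"
    hence "-z \<notin> \<real>\<^sub>\<le>\<^sub>0" by (auto simp: complex_nonpos_Reals_iff complex_eq_iff)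
    thus "((\<lambda>z. Ln (-z)) has_field_derivative 1 / z) (at z within {z. Re z \<le> 0} - {0})"
      by (auto intro!: derivative_eq_intros simp: inverse_eq_divide)
  qed (use \<gamma> in auto)
  hence 2: "((\<lambda>z. 1/z) has_contour_integral \<i> * pi) \<gamma>"
    using LnR by (simp add: \<gamma>)
  have "((\<lambda>z. 1/z) has_contour_integral \<i> * pi + \<i> * pi) (right_arc R +++ \<gamma>)"
    using 1 2 \<gamma> by (intro has_contour_integral_join) auto
  moreover have "valid_path (right_arc R +++ \<gamma>)" "0 \<notin> path_image (right_arc R +++ \<gamma>)"
    using \<gamma> right by (auto simp: arc_endpoints path_image_join valid_path_join)
  ultimately show ?thesis
    using contour_integral_unique[of "\<lambda>z. 1/z" "\<i> * pi + \<i> * pi" "right_arc R +++ \<gamma>"]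
    by (simp add: winding_number_valid_path)
qed

text \<open>This is Cauchy's formula for F(z) (1 + z^2/R^2), which agrees with F at 0 and equals z
  times F times the kernel elsewhere. The left path stays a parameter because f and its partial sums
  need different ones.\<close>

lemma newman_contour_integral:
  assumes R: "R > 0" and U: "convex U" "open U" "0 \<in> U" and F: "F holomorphic_on U"
    and \<gamma>: "valid_path \<gamma>" "path_image \<gamma> \<subseteq> {z. Re z \<le> 0} - {0}" "path_image \<gamma> \<subseteq> U"
      "pathstart \<gamma> = \<i> * R" "pathfinish \<gamma> = - (\<i> * R)"
    and arc: "path_image (right_arc R) \<subseteq> U"
  shows "(\<lambda>z. F z * newman_kernel R z) contour_integrable_on right_arc R"
    and "(\<lambda>z. F z * newman_kernel R z) contour_integrable_on \<gamma>"
    and "contour_integral (right_arc R) (\<lambda>z. F z * newman_kernel R z)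
          + contour_integral \<gamma> (\<lambda>z. F z * newman_kernel R z) = 2 * pi * \<i> * F 0"
proof -
  define G where "G = (\<lambda>z. F z * (1 + z^2 / of_real R ^ 2))"
  have G: "G holomorphic_on U" unfolding G_def by (intro holomorphic_intros F) (use R in auto)
  have 0: "0 \<notin> path_image (right_arc R)"
    using right_arc_image[OF R] R by force
  have eq: "G z / (z - 0) = F z * newman_kernel R z" if "z \<noteq> 0" for z
    using that by (simp add: G_def field_simps power2_eq_square)
  have "((\<lambda>z. G z / (z - 0)) has_contour_integral
          2 * pi * \<i> * winding_number (right_arc R +++ \<gamma>) 0 * G 0) (right_arc R +++ \<gamma>)"
    using U \<gamma> arc 0 by (intro Cauchy_integral_formula_convex_simple[OF U(1) G])
      (auto simp: arc_endpoints path_image_join interior_open valid_path_join)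
  hence *: "((\<lambda>z. G z / (z - 0)) has_contour_integral 2 * pi * \<i> * F 0) (right_arc R +++ \<gamma>)"
    using winding_number_right_arc_join[OF R \<gamma>(1,2,4,5)] by (simp add: G_def)
  have "((\<lambda>z. F z * newman_kernel R z) has_contour_integral 2 * pi * \<i> * F 0) (right_arc R +++ \<gamma>)"
    by (rule has_contour_integral_eq[OF *], rule eq)
       (use 0 \<gamma> in \<open>auto simp: path_image_join arc_endpoints\<close>)
  moreover from this show int: "(\<lambda>z. F z * newman_kernel R z) contour_integrable_on right_arc R"
    "(\<lambda>z. F z * newman_kernel R z) contour_integrable_on \<gamma>"
    using \<gamma>(1) contour_integrable_joinD1 contour_integrable_joinD2 has_contour_integral_integrable
      valid_path_arcs(1) by blast+
  ultimately show "contour_integral (right_arc R) (\<lambda>z. F z * newman_kernel R z)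
          + contour_integral \<gamma> (\<lambda>z. F z * newman_kernel R z) = 2 * pi * \<i> * F 0"
    using \<gamma>(1) by (subst contour_integral_join [symmetric]) (auto simp: contour_integral_unique)
qed

lemma newman_kernel_on_circle:
  assumes "norm z = R" "R > 0"
  shows "norm (newman_kernel R z) = 2 * \<bar>Re z\<bar> / R^2"
proof -
  have "z * cnj z = of_real (R^2)" using assms by (simp add: complex_norm_square [symmetric])
  hence "1 / z = cnj z / of_real R ^ 2" using assms by (auto simp: field_simps)
  hence "newman_kernel R z = (z + cnj z) / of_real R ^ 2" by (simp add: add_divide_distrib)
  also have "\<dots> = of_real (2 * Re z / R^2)" by (simp add: complex_add_cnj)
  finally show ?thesis by (simp only: norm_of_real) (simp add: abs_mult)
qed

section \<open>Bounds for tails and partial sums of Dirichlet series with bounded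
  coefficients\<close>

lemma powr_neg_le_telescope:
  fixes x :: real
  assumes "x > 0" "n > 0"
  shows "real (Suc n) powr (-1-x) \<le> (real n powr (-x) - real (Suc n) powr (-x)) / x"
proof -
  have "\<exists>z>real n. z < real (Suc n) \<and> real (Suc n) powr (-x) - real n powr (-x) =
          (real (Suc n) - real n) * ((-x) * z powr (-x-1))"
    using assms by (intro MVT2) (auto intro!: derivative_eq_intros)
  then obtain z where z: "z > real n" "z < real (Suc n)"
    "real (Suc n) powr (-x) - real n powr (-x) = (-x) * z powr (-x-1)" by auto
  have "real (Suc n) powr (-1-x) \<le> z powr (-1-x)"
    using assms z by (intro powr_mono2') auto
  also have "z powr (-1-x) = z powr (-x-1)" by (rule arg_cong[of _ _ "(powr) z"]) simp
  also have "z powr (-x-1) = (x * z powr (-x-1)) / x" using assms by simp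
  also have "x * z powr (-x-1) = real n powr (-x) - real (Suc n) powr (-x)" using z(3) by linarith
  finally show ?thesis .
qed

text \<open>Comparison with the integral of t powr (x - 1) gives the term 1/x. If x \<ge> 1 the
  integrand increases and the comparison misses the last summand, which accounts for 1/N; otherwise
  it decreases and nothing is missed.\<close>

lemma sum_powr_le:
  fixes x :: real
  assumes x: "x > 0" and N: "N > 0"
  shows "(\<Sum>n\<le>N. real n powr (x-1)) \<le> real N powr x * (1 / x + 1 / real N)"
proof -
  have mvt: "\<exists>z>real n. z < real (Suc n) \<and> z powr (x-1) = real (Suc n) powr x / x - real n powr x / x"
    if "n > 0" for n
  proof -
    have "\<exists>z>real n. z < real (Suc n) \<and> real (Suc n) powr x - real n powr x =
            (real (Suc n) - real n) * (x * z powr (x-1))"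
      using x that by (intro MVT2) (auto intro!: derivative_eq_intros)
    then obtain z where "z > real n" "z < real (Suc n)"
      "real (Suc n) powr x - real n powr x = (real (Suc n) - real n) * (x * z powr (x-1))"
      by blast
    moreover from this have "real (Suc n) powr x - real n powr x = x * z powr (x-1)" by simp
    hence "(real (Suc n) powr x - real n powr x) / x = z powr (x-1)" using x by simp
    ultimately show ?thesis by (metis diff_divide_distrib)
  qed
  have e: "real N powr x * (1 / x + 1 / real N) = real N powr x / x + real N powr (x-1)" 
  proof -
    have "real N powr (x-1) = real N powr x / real N"
      unfolding powr_diff using N by (subst powr_one) simp_all
    thus ?thesis by (simp only: distrib_left times_divide_eq_right mult_1_right)
  qed
  have "(\<Sum>n\<le>N. real n powr (x-1)) \<le> real N powr x / x + real N powr (x-1)"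
  proof (cases "x \<ge> 1")
    case True
    show "(\<Sum>n\<le>N. real n powr (x-1)) \<le> real N powr x / x + real N powr (x-1)" using N
    proof (induction N rule: nat_induct_non_zero)
      case (Suc n)
      obtain z where z: "z > real n" "z < real (Suc n)"
          "z powr (x-1) = real (Suc n) powr x / x - real n powr x / x"
        using mvt[OF Suc.hyps] by (elim exE conjE) (rule that)
      have "real n powr (x-1) \<le> z powr (x-1)" using True z by (intro powr_mono2) auto
      thus ?case using Suc.IH z(3) unfolding sum.atMost_Suc by linarith
    qed (use x in auto)
  next
    case False
    have "(\<Sum>n\<le>N. real n powr (x-1)) \<le> real N powr x / x" using N
    proof (induction N rule: nat_induct_non_zero)
      case (Suc n)
      obtain z where z: "z > real n" "z < real (Suc n)"
          "z powr (x-1) = real (Suc n) powr x / x - real n powr x / x"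
        using mvt[OF Suc.hyps] by (elim exE conjE) (rule that)
      have "real (Suc n) powr (x-1) \<le> z powr (x-1)" using False z by (intro powr_mono2') auto
      thus ?case using Suc.IH z(3) unfolding sum.atMost_Suc by linarith
    qed (use x False in auto)
    thus "(\<Sum>n\<le>N. real n powr (x-1)) \<le> real N powr x / x + real N powr (x-1)"
      by (simp add: add_increasing2)
  qed
  thus ?thesis by (simp only: e)
qed

lemma norm_of_nat_powr: "norm (of_nat n powr s :: complex) = real n powr Re s"
  by (subst norm_powr_real_powr) auto

text \<open>Beyond N each term is dominated by B times a difference of consecutive values of t powr
  (-Re z) / Re z, so the bound telescopes to its value at N.\<close>

lemma norm_dirichlet_tail_le:
  fixes b :: "nat \<Rightarrow> complex"
  assumes B: "\<And>n. norm (b n) \<le> B" and z: "Re z > 0" and N: "N > 0"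
    and sums: "(\<lambda>n. b n * of_nat n powr (-1-z)) sums f"
  shows "norm (f - (\<Sum>n\<le>N. b n * of_nat n powr (-1-z))) \<le> B * (real N powr (-Re z) / Re z)"
proof -
  have B0: "B \<ge> 0" using B[of 0] norm_ge_zero[of "b 0"] by linarith
  define g where "g = (\<lambda>n. real (n + N) powr (-Re z) / Re z)"
  have "(\<lambda>n. real n powr (-Re z)) \<longlonglongrightarrow> 0"
    using z by (intro tendsto_neg_powr filterlim_real_sequentially) auto
  hence "(\<lambda>n. real (n + N) powr (-Re z)) \<longlonglongrightarrow> 0" by (rule LIMSEQ_ignore_initial_segment)
  from tendsto_divide[OF this tendsto_const[of "Re z"]] z have "g \<longlonglongrightarrow> 0" by (simp add: g_def)
  from telescope_sums'[OF this] have "(\<lambda>n. g n - g (Suc n)) sums g 0" by simp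
  from sums_mult[OF this, of B] have g: "(\<lambda>n. B * (g n - g (Suc n))) sums (B * g 0)" .
  have tail: "(\<lambda>n. b (n + Suc N) * of_nat (n + Suc N) powr (-1-z)) sums
          (f - (\<Sum>n<Suc N. b n * of_nat n powr (-1-z)))"
    by (rule sums_split_initial_segment[OF sums])
  have le: "norm (b (n + Suc N) * of_nat (n + Suc N) powr (-1-z)) \<le> B * (g n - g (Suc n))" for n
  proof -
    have "norm (b (n + Suc N) * of_nat (n + Suc N) powr (-1-z))
            = norm (b (n + Suc N)) * real (Suc (n + N)) powr (-1-Re z)"
      by (simp only: norm_mult norm_of_nat_powr) simp
    also have "\<dots> \<le> B * ((real (n + N) powr (-Re z) - real (Suc (n + N)) powr (-Re z)) / Re z)"
      using z N B0 by (intro mult_mono B powr_neg_le_telescope) auto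
    finally show ?thesis by (simp only: g_def add_Suc diff_divide_distrib)
  qed
  have "norm (\<Sum>n. b (n + Suc N) * of_nat (n + Suc N) powr (-1-z)) \<le> (\<Sum>n. B * (g n - g (Suc n)))"
    by (rule norm_suminf_le[OF le]) (use g in \<open>simp add: sums_iff\<close>)
  thus ?thesis
    using tail g by (simp add: sums_iff lessThan_Suc_atMost g_def)
qed

lemma norm_dirichlet_partial_sum_le:
  fixes b :: "nat \<Rightarrow> complex"
  assumes B: "\<And>n. norm (b n) \<le> B" and z: "Re z < 0" and N: "N > 0"
  shows "norm (\<Sum>n\<le>N. b n * of_nat n powr (-1-z)) \<le> B * (real N powr (-Re z) * (1 / (-Re z) + 1 / real N))"
proof -
  have B0: "B \<ge> 0" using B[of 0] norm_ge_zero[of "b 0"] by linarith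
  have "norm (\<Sum>n\<le>N. b n * of_nat n powr (-1-z)) \<le> (\<Sum>n\<le>N. B * real n powr (-Re z - 1))"
  proof (rule sum_norm_le)
    fix n assume "n \<in> {..N}"
    have "norm (b n * of_nat n powr (-1-z)) = norm (b n) * real n powr (-1 - Re z)"
      by (simp add: norm_mult norm_of_nat_powr)
    also have "\<dots> \<le> B * real n powr (-1 - Re z)" by (intro mult_right_mono B) auto
    also have "-1 - Re z = -Re z - 1" by simp
    finally show "norm (b n * of_nat n powr (-1-z)) \<le> B * real n powr (-Re z - 1)" .
  qed
  also have "\<dots> = B * (\<Sum>n\<le>N. real n powr (-Re z - 1))" by (simp add: sum_distrib_left)
  also have "\<dots> \<le> B * (real N powr (-Re z) * (1 / (-Re z) + 1 / real N))"
    using z N B0 by (intro mult_left_mono sum_powr_le) auto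
  finally show ?thesis .
qed

text \<open>Analyticity on the closed half-plane gives a neighbourhood that may become arbitrarily
  thin as |Im z| grows. Compactness of a segment of the imaginary axis gives a uniform width d up to
  height R. The resulting half-strip is convex, as Cauchy's formula in the form used here
  requires.\<close>

lemma newman_convex_domain:
  assumes "f analytic_on {z. Re z \<ge> 0}" and "R > 0"
  obtains d where "d > 0" "f holomorphic_on {z. Re z > -d \<and> \<bar>Im z\<bar> < R}"
proof -
  obtain T where T: "open T" "{z. Re z \<ge> 0} \<subseteq> T" "f holomorphic_on T"
    using assms(1) by (auto simp: analytic_on_holomorphic)
  \<comment> \<open>A degenerate box: both corners have real part 0, so it is the segment from -iR
    to iR.\<close>
  define C where "C = cbox (-(\<i> * of_real R)) (\<i> * of_real R)"
  have "compact C" by (simp add: C_def)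
  moreover have "C \<subseteq> {z. Re z \<ge> 0}" by (auto simp: C_def in_cbox_complex_iff)
  hence "C \<inter> -T = {}" using T(2) by blast
  ultimately obtain d where d: "d > 0" "\<forall>x\<in>C. \<forall>y\<in>-T. d \<le> dist x y"
    using separate_compact_closed[of C "-T"] T(1) by (auto simp: closed_Compl)
  have "z \<in> T" if "Re z > -d" "\<bar>Im z\<bar> < R" for z
  proof (cases "Re z \<ge> 0")
    case False
    have "dist (\<i> * of_real (Im z)) z = norm (complex_of_real (- Re z))"
      unfolding dist_norm by (rule arg_cong[where f = norm]) (simp add: complex_eq_iff)
    also have "\<dots> < d" using False that by simp
    finally have "dist (\<i> * of_real (Im z)) z < d" .
    moreover have "\<i> * of_real (Im z) \<in> C" using that by (auto simp: C_def in_cbox_complex_iff)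
    ultimately have "\<not> z \<in> -T" using d(2) linorder_not_le by blast
    thus ?thesis by simp
  qed (use T in auto)
  hence "{z. Re z > -d \<and> \<bar>Im z\<bar> < R} \<subseteq> T" by auto
  thus ?thesis using that d(1) T(3) holomorphic_on_subset by blast
qed

text \<open>
  The partial sums are entire, so for them the contour is the full circle; for \<open>f\<close> the left arc is
  replaced by three segments slightly to the left of the imaginary axis. On the circle the kernel
  has modulus \<open>2 \<bar>Re z\<bar> / R\<^sup>2\<close>, which cancels the factor \<open>1 / Re z\<close> in the bound on the tail.
\<close>
theorem newman_dirichlet_series:
  fixes b :: "nat \<Rightarrow> complex"
  assumes B: "\<And>n. norm (b n) \<le> B" and f: "f analytic_on {z. Re z \<ge> 0}"
    and sums: "\<And>z. Re z > 0 \<Longrightarrow> (\<lambda>n. b n * of_nat n powr (-1-z)) sums f z"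
  shows "(\<lambda>n. b n / of_nat n) sums f 0"
proof -
  have B0: "B \<ge> 0" using B[of 0] norm_ge_zero[of "b 0"] by linarith
  define S where "S = (\<lambda>N z. \<Sum>n\<le>N. b n * of_nat n powr (-1-z))"
  have "(\<lambda>N. S N 0) \<longlonglongrightarrow> f 0"
  proof (rule tendstoI)
    fix e :: real assume e: "e > 0"
    \<comment> \<open>The two arcs together will contribute 2 pi (3 B / R), which has to stay below
      half of 2 pi e. Using B + 1 keeps R positive when B = 0.\<close>
    define R where "R = 6 * (B + 1) / e"
    have R: "R > 0" using B0 e by (simp add: R_def)
    have BR: "3 * B / R < e / 2"
      using B0 e by (simp add: R_def field_simps)
    obtain d where d: "d > 0" "f holomorphic_on {z. Re z > -d \<and> \<bar>Im z\<bar> < R + 1}"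
      using newman_convex_domain[OF f, of "R + 1"] R by auto
    define U where "U = {z. Re z > -d \<and> \<bar>Im z\<bar> < R + 1}"
    have U_eq: "U = {z. Re z > -d} \<inter> {z. Im z < R + 1} \<inter> {z. Im z > -(R + 1)}"
      by (auto simp: U_def)
    have U: "convex U" "open U" "0 \<in> U"
      using d R unfolding U_eq
      by (auto intro!: convex_Int open_Int convex_halfspace_Re_gt convex_halfspace_Im_lt
          convex_halfspace_Im_gt open_halfspace_Re_gt open_halfspace_Im_lt open_halfspace_Im_gt)
    have fU: "f holomorphic_on U" using d by (simp add: U_def)
    \<comment> \<open>The bound M is taken over a rectangle that does not depend on \<delta>, since
      \<delta> is chosen in terms of M.\<close>
    define Q where "Q = cbox (Complex (-(d/2)) (-R)) (Complex 0 R)"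
    have QU: "Q \<subseteq> U" using d R by (auto simp: Q_def U_def in_cbox_complex_iff)
    have "compact (f ` Q)"
      by (intro compact_continuous_image holomorphic_on_imp_continuous_on
            holomorphic_on_subset[OF fU QU]) (simp add: Q_def)
    then obtain M where M: "M > 0" "\<And>z. z \<in> Q \<Longrightarrow> norm (f z) \<le> M"
      using bounded_pos compact_imp_bounded by (metis imageI)
    \<comment> \<open>The bound d/2 keeps the segments inside Q, R keeps norm z \<le> 2 R on them,
      and R e / (8 M) makes the two horizontal segments contribute at most 6 M \<delta> / R \<le> 3
      e / 4. The remaining e/4 is left to the vertical one.\<close>
    define \<delta> where "\<delta> = min (d/2) (min R (R * e / (8 * M)))"
    have \<delta>: "\<delta> > 0" "\<delta> \<le> d/2" "\<delta> \<le> R" using d R e M by (auto simp: \<delta>_def)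
    have "\<delta> \<le> R * e / (8 * M)" by (simp add: \<delta>_def)
    hence M\<delta>: "6 * M * \<delta> / R \<le> 3 * e / 4" using R M by (simp add: field_simps)
    define \<gamma>1 \<gamma>2 \<gamma>3 where "\<gamma>1 = linepath (\<i> * R) (Complex (-\<delta>) R)"
      and "\<gamma>2 = linepath (Complex (-\<delta>) R) (Complex (-\<delta>) (-R))"
      and "\<gamma>3 = linepath (Complex (-\<delta>) (-R)) (- (\<i> * R))"
    define \<gamma> where "\<gamma> = \<gamma>1 +++ \<gamma>2 +++ \<gamma>3"
    have im1: "path_image \<gamma>1 \<subseteq> {z. -\<delta> \<le> Re z \<and> Re z \<le> 0 \<and> Im z = R}"
      using \<delta> by (auto simp: \<gamma>1_def closed_segment_same_Im closed_segment_eq_real_ivl)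
    have im2: "path_image \<gamma>2 \<subseteq> {z. Re z = -\<delta> \<and> \<bar>Im z\<bar> \<le> R}"
      using R by (auto simp: \<gamma>2_def closed_segment_same_Re closed_segment_eq_real_ivl)
    have im3: "path_image \<gamma>3 \<subseteq> {z. -\<delta> \<le> Re z \<and> Re z \<le> 0 \<and> Im z = -R}"
      using \<delta> by (auto simp: \<gamma>3_def closed_segment_same_Im closed_segment_eq_real_ivl)
    have vp: "valid_path \<gamma>1" "valid_path \<gamma>2" "valid_path \<gamma>3"
      by (simp_all add: \<gamma>1_def \<gamma>2_def \<gamma>3_def)
    have ends: "pathfinish \<gamma>1 = pathstart \<gamma>2" "pathfinish \<gamma>2 = pathstart \<gamma>3"
      "pathstart \<gamma>1 = \<i> * R" "pathfinish \<gamma>3 = - (\<i> * R)"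
      by (simp_all add: \<gamma>1_def \<gamma>2_def \<gamma>3_def)
    have imQ: "path_image \<gamma>1 \<subseteq> Q" "path_image \<gamma>2 \<subseteq> Q" "path_image \<gamma>3 \<subseteq> Q"
      using im1 im2 im3 R \<delta> by (force simp: Q_def in_cbox_complex_iff)+
    have im\<gamma>: "path_image \<gamma> = path_image \<gamma>1 \<union> path_image \<gamma>2 \<union> path_image \<gamma>3"
      by (auto simp: \<gamma>_def path_image_join ends)
    have \<gamma>: "valid_path \<gamma>" "path_image \<gamma> \<subseteq> {z. Re z \<le> 0} - {0}" "path_image \<gamma> \<subseteq> U"
      "pathstart \<gamma> = \<i> * R" "pathfinish \<gamma> = - (\<i> * R)"
    proof -
      show "valid_path \<gamma>" by (simp add: \<gamma>_def vp valid_path_join ends)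
      show "path_image \<gamma> \<subseteq> {z. Re z \<le> 0} - {0}"
        unfolding im\<gamma> using im1 im2 im3 R \<delta> by (force simp: complex_eq_iff)
      show "path_image \<gamma> \<subseteq> U" unfolding im\<gamma> using imQ QU by blast
    qed (simp_all add: \<gamma>_def ends)
    have rU: "path_image (right_arc R) \<subseteq> U"
    proof
      fix z assume "z \<in> path_image (right_arc R)"
      thus "z \<in> U" using right_arc_image[OF R] abs_Im_le_cmod[of z] d by (force simp: U_def)
    qed
    have lL: "path_image (left_arc R) \<subseteq> {z. Re z \<le> 0} - {0}"
      using left_arc_image[OF R] R by force
    define K\<delta> where "K\<delta> = 1 / \<delta> + 2 / R"
    have kernel_le: "norm (newman_kernel R z) \<le> 1 / norm z + 2 / R" if "norm z \<le> 2 * R" for z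
    proof -
      have "norm (newman_kernel R z) \<le> 1 / norm z + norm z / R ^ 2"
        using norm_triangle_ineq[of "1/z" "z / of_real R ^ 2"] R
        by (simp add: norm_divide norm_power)
      also have "norm z / R ^ 2 \<le> 2 * R / R ^ 2" using that R by (intro divide_right_mono) auto
      also have "2 * R / R ^ 2 = 2 / R" using R by (simp add: power2_eq_square)
      finally show ?thesis by simp
    qed
    \<comment> \<open>On the vertical segment the factor N^z introduced below has modulus
      N^(-\<delta>). As \<delta>, M and R are fixed before N, this beats the large constant
      1/\<delta> in \<open>K\<delta>\<close>.\<close>
    have "(\<lambda>N. real N powr (-\<delta>)) \<longlonglongrightarrow> 0"
      using \<delta> by (intro tendsto_neg_powr filterlim_real_sequentially) auto
    hence "(\<lambda>N. real N powr (-\<delta>) * (M * K\<delta> * (2 * R))) \<longlonglongrightarrow> 0"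
      by (rule tendsto_mult_left_zero)
    moreover have "e / 4 > 0" using e by simp
    ultimately have ev: "eventually (\<lambda>N. real N powr (-\<delta>) * (M * K\<delta> * (2 * R)) < e / 4) sequentially"
      by (rule order_tendstoD)
    show "eventually (\<lambda>N. dist (S N 0) (f 0) < e) sequentially"
      using ev eventually_ge_at_top[of "nat \<lceil>R\<rceil>"] eventually_gt_at_top[of 0]
    proof eventually_elim
      case (elim N)
      have NR: "real N \<ge> R" using elim by linarith
      have N: "N > 0" using elim by simp
      \<comment> \<open>The factor N^z is 1 at 0, so Cauchy's formula still returns f 0 and S N 0.
        Its modulus cancels the N^(-Re z) in the bounds for both the tail and the partial sum, and
        it decays to the left of the axis, where only a bound on f is available.\<close>
      define E where "E = (\<lambda>z. of_nat N powr z :: complex)"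
      have normE: "norm (E z) = real N powr Re z" for z by (simp add: E_def norm_of_nat_powr)
      have SE: "(\<lambda>z. S N z * E z) holomorphic_on A" for A
        unfolding S_def E_def by (intro holomorphic_intros)
      have fE: "(\<lambda>z. f z * E z) holomorphic_on U"
        unfolding E_def by (intro holomorphic_intros fU)
      note I1 = newman_contour_integral[OF R U fE \<gamma>(1-5) rU]
      note I2 = newman_contour_integral[OF R _ _ _ SE[of UNIV], of "left_arc R", simplified, OF lL]
      have E0: "E 0 = 1" using N by (simp add: E_def)

      have bound_right: "norm (contour_integral (right_arc R) (\<lambda>z. f z * E z * newman_kernel R z)
          - contour_integral (right_arc R) (\<lambda>z. S N z * E z * newman_kernel R z))
          \<le> 2 * B / R^2 * R * (pi/2 - (-(pi/2)))"
      proof -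
        have "norm (contour_integral (right_arc R)
               (\<lambda>z. f z * E z * newman_kernel R z - S N z * E z * newman_kernel R z))
             \<le> 2 * B / R^2 * R * (pi/2 - (-(pi/2)))"
          unfolding right_arc_def
        proof (rule contour_integral_bound_part_circlepath_strong[where k = "{}"])
          fix z assume "z \<in> path_image (part_circlepath 0 R (-(pi/2)) (pi/2)) - {}"
          hence z: "norm z = R" "Re z \<ge> 0" using right_arc_image[OF R] by (auto simp: right_arc_def)
          note k = newman_kernel_on_circle[OF z(1) R]
          show "norm (f z * E z * newman_kernel R z - S N z * E z * newman_kernel R z) \<le> 2 * B / R^2"
          \<comment> \<open>At the endpoints \<plusminus>iR the series is not known to converge to
            f, but there the kernel vanishes.\<close>
          proof (cases "Re z = 0")
            case True
            hence "norm (newman_kernel R z) = 0" using k by simp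
            hence "newman_kernel R z = 0" by (simp only: norm_eq_zero)
            thus ?thesis using B0 by (simp only:) simp
          next
            case False
            with z have x: "Re z > 0" by simp
            have "f z * E z * newman_kernel R z - S N z * E z * newman_kernel R z
                    = (f z - S N z) * (E z * newman_kernel R z)"
              by (simp only: left_diff_distrib mult.assoc)
            also have "norm \<dots> = norm (f z - S N z) * (real N powr Re z * (2 * Re z / R^2))"
              using x by (simp only: norm_mult normE k abs_of_pos)
            also have "\<dots> \<le> (B * (real N powr (-Re z) / Re z)) * (real N powr Re z * (2 * Re z / R^2))"
              unfolding S_def using x
              by (intro mult_right_mono norm_dirichlet_tail_le[OF B x N sums[OF x]]) auto
            also have "\<dots> = (real N powr (-Re z) * real N powr Re z) * (2 * B / R^2)"
              using x by (simp add: field_simps)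
            also have "real N powr (-Re z) * real N powr Re z = 1"
              using N by (simp add: powr_minus)
            finally show ?thesis by simp
          qed
        qed (use R B0 I1(1) I2(1) in \<open>auto simp: right_arc_def [symmetric] intro!: contour_integrable_diff\<close>)
        thus ?thesis using I1(1) I2(1) by (simp only: contour_integral_diff)
      qed

      have bound_left: "norm (contour_integral (left_arc R) (\<lambda>z. S N z * E z * newman_kernel R z))
          \<le> 4 * B / R^2 * R * (3*pi/2 - pi/2)"
        unfolding left_arc_def
      proof (rule contour_integral_bound_part_circlepath_strong[where k = "{}"])
        fix z assume "z \<in> path_image (part_circlepath 0 R (pi/2) (3*pi/2)) - {}"
        hence z: "norm z = R" "Re z \<le> 0" using left_arc_image[OF R] by (auto simp: left_arc_def)
        note k = newman_kernel_on_circle[OF z(1) R]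
        show "norm (S N z * E z * newman_kernel R z) \<le> 4 * B / R^2"
        proof (cases "Re z = 0")
          case True
          hence "norm (newman_kernel R z) = 0" using k by simp
          hence "newman_kernel R z = 0" by (simp only: norm_eq_zero)
          thus ?thesis using B0 by (simp only:) simp
        next
          case False
          with z have x: "Re z < 0" by simp
          have xR: "- Re z \<le> R" using abs_Re_le_cmod[of z] z by simp
          have "norm (S N z * E z * newman_kernel R z)
                  = norm (S N z) * (real N powr Re z * (2 * (-Re z) / R^2))"
            using x by (simp only: norm_mult normE k abs_of_neg)
          also have "\<dots> \<le> (B * (real N powr (-Re z) * (1 / (-Re z) + 1 / real N)))
                            * (real N powr Re z * (2 * (-Re z) / R^2))"
            unfolding S_def using x
            by (intro mult_right_mono[OF norm_dirichlet_partial_sum_le[OF B x N]]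
                mult_nonneg_nonneg divide_nonneg_nonneg) auto
          also have "\<dots> = (real N powr (-Re z) * real N powr Re z) * (2 * B / R^2) * (1 + (-Re z) / real N)"
            using x N R by (simp add: field_simps)
          also have "real N powr (-Re z) * real N powr Re z = 1"
            using N by (simp add: powr_minus)
          \<comment> \<open>Here N \<ge> R enters: it absorbs the summand 1/N of the partial sum
            bound, because -Re z \<le> R \<le> N.\<close>
          also have "1 * (2 * B / R^2) * (1 + (-Re z) / real N) \<le> 1 * (2 * B / R^2) * 2"
          proof (rule mult_left_mono)
            have "(-Re z) / real N \<le> 1" using xR NR N by (subst divide_le_eq_1_pos) auto
            thus "1 + (-Re z) / real N \<le> 2" by simp
          qed (use B0 in auto)
          finally show ?thesis by simp
        qed
      qed (use R B0 I2(2) in \<open>auto simp: left_arc_def [symmetric]\<close>)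

      define g where "g = (\<lambda>z. f z * E z * newman_kernel R z)"
      have "g contour_integrable_on \<gamma>" using I1(2) by (simp add: g_def)
      hence int: "g contour_integrable_on \<gamma>1" "g contour_integrable_on \<gamma>2" "g contour_integrable_on \<gamma>3"
        unfolding \<gamma>_def using contour_integrable_joinD1 contour_integrable_joinD2
        by (metis vp valid_path_join ends pathstart_join)+
      have split: "contour_integral \<gamma> g = contour_integral \<gamma>1 g + (contour_integral \<gamma>2 g + contour_integral \<gamma>3 g)"
        unfolding \<gamma>_def using int vp ends by (simp add: valid_path_join contour_integrable_joinI)
      have g_le: "norm (g z) \<le> M * 1 * (3 / R)"
        if "z \<in> Q" "\<bar>Im z\<bar> = R" "-\<delta> \<le> Re z" "Re z \<le> 0" for z
      proof -
        have zR: "norm z \<ge> R" using abs_Im_le_cmod[of z] that by simp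
        have "norm z \<le> 2 * R" using cmod_le[of z] that \<delta> by linarith
        hence "norm (newman_kernel R z) \<le> 1 / norm z + 2 / R" by (rule kernel_le)
        also have "1 / norm z \<le> 1 / R" using zR R by (intro divide_left_mono mult_pos_pos) auto
        finally have k: "norm (newman_kernel R z) \<le> 3 / R" by simp
        have "real N powr Re z \<le> real N powr 0" using that N by (intro powr_mono) auto
        hence "norm (E z) \<le> 1" using N by (simp add: normE)
        thus ?thesis unfolding g_def norm_mult
          using M that k R by (intro mult_mono) auto
      qed
      have b1: "norm (contour_integral \<gamma>1 g) \<le> (M * 1 * (3 / R)) * norm (Complex (-\<delta>) R - \<i> * R)"
        using int(1) im1 imQ(1) R M unfolding \<gamma>1_def
        by (intro contour_integral_bound_linepath g_le) auto
      have b3: "norm (contour_integral \<gamma>3 g) \<le> (M * 1 * (3 / R)) * norm (- (\<i> * R) - Complex (-\<delta>) (-R))"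
        using int(3) im3 imQ(3) R M unfolding \<gamma>3_def
        by (intro contour_integral_bound_linepath g_le) auto
      have b2: "norm (contour_integral \<gamma>2 g) \<le> (M * real N powr (-\<delta>) * K\<delta>)
                   * norm (Complex (-\<delta>) (-R) - Complex (-\<delta>) R)"
        unfolding \<gamma>2_def
      proof (rule contour_integral_bound_linepath)
        fix z assume "z \<in> closed_segment (Complex (-\<delta>) R) (Complex (-\<delta>) (-R))"
        hence z: "Re z = -\<delta>" "\<bar>Im z\<bar> \<le> R" "z \<in> Q" using im2 imQ(2) by (auto simp: \<gamma>2_def)
        have zd: "norm z \<ge> \<delta>" using abs_Re_le_cmod[of z] z \<delta> by simp
        have "norm z \<le> 2 * R" using cmod_le[of z] z \<delta> by linarith
        hence "norm (newman_kernel R z) \<le> 1 / norm z + 2 / R" by (rule kernel_le)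
        also have "1 / norm z \<le> 1 / \<delta>" using zd \<delta> by (intro divide_left_mono mult_pos_pos) auto
        finally have k: "norm (newman_kernel R z) \<le> K\<delta>" by (simp add: K\<delta>_def)
        show "norm (g z) \<le> M * real N powr (-\<delta>) * K\<delta>"
          unfolding g_def norm_mult normE z(1) using M z k
          by (intro mult_mono) auto
      qed (use M R \<delta> int(2) in \<open>auto simp: \<gamma>2_def K\<delta>_def\<close>)
      have n1: "norm (Complex (-\<delta>) R - \<i> * R) = \<delta>" "norm (- (\<i> * R) - Complex (-\<delta>) (-R)) = \<delta>"
  using \<delta> R by (simp_all add: cmod_def power2_eq_square)
      have "norm (Complex (-\<delta>) (-R) - Complex (-\<delta>) R) = sqrt ((2 * R)^2)"
        unfolding cmod_def by (rule arg_cong[where f = sqrt]) (simp add: power2_eq_square)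
      also have "\<dots> = 2 * R" unfolding real_sqrt_abs using R by simp
      finally have n2: "norm (Complex (-\<delta>) (-R) - Complex (-\<delta>) R) = 2 * R" .
      have "norm (contour_integral \<gamma> g) \<le> (M * 1 * (3 / R)) * \<delta> + (M * real N powr (-\<delta>) * K\<delta>) * (2 * R)
              + (M * 1 * (3 / R)) * \<delta>"
        unfolding split
        using norm_triangle_ineq[of "contour_integral \<gamma>1 g" "contour_integral \<gamma>2 g + contour_integral \<gamma>3 g"]
          norm_triangle_ineq[of "contour_integral \<gamma>2 g" "contour_integral \<gamma>3 g"] b1 b2 b3
        unfolding n1 n2 by linarith
      also have "\<dots> = 6 * M * \<delta> / R + real N powr (-\<delta>) * (M * K\<delta> * (2 * R))" by (simp add: field_simps)
      also have "\<dots> < e" using M\<delta> elim(1) by linarith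
      finally have bound_\<gamma>: "norm (contour_integral \<gamma> g) < e" .

      define right left where
        "right = contour_integral (right_arc R) (\<lambda>z. f z * E z * newman_kernel R z)
            - contour_integral (right_arc R) (\<lambda>z. S N z * E z * newman_kernel R z)"
        and "left = contour_integral (left_arc R) (\<lambda>z. S N z * E z * newman_kernel R z)"
      \<comment> \<open>Difference of the two Cauchy formulas: the right arcs are kept together, so
        that only the tail f - S is integrated there, while the left paths are bounded
        separately.\<close>
      have "2 * pi * \<i> * f 0 - 2 * pi * \<i> * S N 0 = right + contour_integral \<gamma> g - left"
        using I1(3) I2(3) E0 unfolding g_def right_def left_def by (simp add: algebra_simps)
      also have "norm \<dots> < 2 * B / R^2 * R * (pi/2 - (-(pi/2))) + e + 4 * B / R^2 * R * (3*pi/2 - pi/2)"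
        using bound_right bound_left bound_\<gamma> norm_triangle_ineq4[of "right + contour_integral \<gamma> g" left]
          norm_triangle_ineq[of right "contour_integral \<gamma> g"]
        unfolding right_def [symmetric] left_def [symmetric] by linarith
      also have "2 * B / R^2 * R * (pi/2 - (-(pi/2))) + e + 4 * B / R^2 * R * (3*pi/2 - pi/2)
                   = 2 * pi * (3 * B / R) + e"
        using R by (simp add: field_simps power2_eq_square)
      also have "\<dots> \<le> 2 * pi * (e / 2) + pi * e"
      proof (rule add_mono)
        show "2 * pi * (3 * B / R) \<le> 2 * pi * (e / 2)" using BR by (intro mult_left_mono) auto
        show "e \<le> pi * e" using pi_gt3 e by simp
      qed
      also have "\<dots> = 2 * pi * e" by simp
      also have "2 * pi * \<i> * f 0 - 2 * pi * \<i> * S N 0 = 2 * pi * \<i> * (f 0 - S N 0)"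
        by (simp add: algebra_simps)
      finally have "2 * pi * norm (f 0 - S N 0) < 2 * pi * e" by (simp add: norm_mult)
      thus ?case by (simp add: dist_norm norm_minus_commute)
    qed
  qed
  moreover have "S N 0 = (\<Sum>n\<le>N. b n / of_nat n)" for N
    by (simp add: S_def powr_minus_divide)
  ultimately show ?thesis by (simp add: sums_def_le)
qed

section \<open>The zeta and von Mangoldt series\<close>

abbreviation npow :: "nat \<Rightarrow> complex \<Rightarrow> complex" where
  "npow n s \<equiv> of_nat n powr (-s)"

text \<open>Second-order Taylor remainder of x powr w at n with step 1, from two applications of the
  mean value inequality. The condition Re w \<le> 2 makes x powr (Re w - 2) nonincreasing, so its
  value at n bounds it on the whole interval. It is applied with w = 1 - s and w = -s.\<close>

lemma norm_powr_Suc_diff_le: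
  fixes w :: complex
  assumes n: "n > 0" and w: "Re w \<le> 2"
  shows "norm (of_nat (Suc n) powr w - of_nat n powr w - w * of_nat n powr (w - 1))
           \<le> norm w * norm (w - 1) * real n powr (Re w - 2)"
proof -
  \<comment> \<open>Subtracting the tangent's linear part makes the derivative of \<open>h\<close> a
    difference of powers, which \<open>inner\<close> bounds.\<close>
  define h where "h = (\<lambda>x. of_real x powr w - w * of_nat n powr (w - 1) * of_real x :: complex)"
  define h' where "h' = (\<lambda>x. w * (of_real x powr (w - 1) - of_nat n powr (w - 1)) :: complex)"
  define C where "C = norm (w - 1) * real n powr (Re w - 2)"
  have inner: "norm (of_real x powr (w - 1) - of_nat n powr (w - 1) :: complex) \<le> C"
    if x: "x \<in> {real n..real n + 1}" for x
  proof -
    have "norm (complex_of_real x powr (w - 1) - of_real (real n) powr (w - 1)) \<le> C * norm (x - real n)"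
    proof (rule differentiable_bound[of "{real n..real n + 1}"])
      fix y assume y: "y \<in> {real n..real n + 1}"
      have "((\<lambda>y. complex_of_real y powr (w - 1)) has_vector_derivative
              ((w - 1) * of_real y powr (w - 1 - 1))) (at y within {real n..real n + 1})"
        using y n by (auto intro!: has_vector_derivative_real_field derivative_eq_intros)
      thus "((\<lambda>y. complex_of_real y powr (w - 1)) has_derivative
              (\<lambda>t. t *\<^sub>R ((w - 1) * of_real y powr (w - 1 - 1)))) (at y within {real n..real n + 1})"
        by (simp add: has_vector_derivative_def)
      have "norm ((w - 1) * of_real y powr (w - 1 - 1)) = norm (w - 1) * y powr (Re w - 2)"
        using y n by (simp add: norm_mult norm_powr_real_powr)
      also have "\<dots> \<le> C"
        unfolding C_def using y n w by (intro mult_left_mono powr_mono2') auto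
      finally have "norm ((w - 1) * of_real y powr (w - 1 - 1)) \<le> C" .
      thus "onorm (\<lambda>t. t *\<^sub>R ((w - 1) * of_real y powr (w - 1 - 1))) \<le> C"
        by (intro onorm_le) (simp add: mult.commute[of C] mult_left_mono)
    qed (use x in auto)
    also have "\<dots> \<le> C * 1"
      using x by (intro mult_left_mono) (auto simp: C_def)
    finally show ?thesis by simp
  qed
  have "norm (h (real n + 1) - h (real n)) \<le> (norm w * C) * norm (real n + 1 - real n)"
  proof (rule differentiable_bound[of "{real n..real n + 1}"])
    fix y assume y: "y \<in> {real n..real n + 1}"
    have "(h has_vector_derivative h' y) (at y within {real n..real n + 1})"
      unfolding h_def h'_def using y n
      by (auto intro!: has_vector_derivative_real_field derivative_eq_intros simp: algebra_simps)
    thus "(h has_derivative (\<lambda>t. t *\<^sub>R h' y)) (at y within {real n..real n + 1})"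
      by (simp add: has_vector_derivative_def)
    have "norm (h' y) \<le> norm w * C"
      unfolding h'_def norm_mult by (intro mult_left_mono inner y) auto
    thus "onorm (\<lambda>t. t *\<^sub>R h' y) \<le> norm w * C"
      by (intro onorm_le) (simp add: mult.commute[of "norm w * C"] mult_left_mono)
  qed auto
  also have "h (real n + 1) - h (real n) = of_nat (Suc n) powr w - of_nat n powr w - w * of_nat n powr (w - 1)"
    by (simp add: h_def algebra_simps)
  finally show ?thesis by (simp add: C_def mult.assoc)
qed

text \<open>A local Weierstrass test. The factor K need only be continuous, hence locally bounded,
  and the exponent a - 1 - Re s stays locally away from -1. The bound is required for n > 0 only,
  since in the applications it can fail at n = 0.\<close>

lemma holomorphic_series_halfplane:
  fixes f :: "nat \<Rightarrow> complex \<Rightarrow> complex"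
  assumes f: "\<And>n. f n holomorphic_on {s. Re s > a}"
    and K: "\<And>s. Re s > a \<Longrightarrow> continuous (at s) K"
    and bound: "\<And>n s. n > 0 \<Longrightarrow> Re s > a \<Longrightarrow> norm (f n s) \<le> K s * real n powr (a - 1 - Re s)"
  shows "(\<lambda>s. \<Sum>n. f n s) holomorphic_on {s. Re s > a}"
    and "Re s > a \<Longrightarrow> summable (\<lambda>n. f n s)"
    and "Re s > a \<Longrightarrow> (\<lambda>n. deriv (f n) s) sums deriv (\<lambda>s. \<Sum>n. f n s) s"
proof -
  define S where "S = {s. Re s > a}"
  have S: "open S" by (simp add: S_def open_halfspace_Re_gt)
  have loc: "\<exists>d h. 0 < d \<and> summable h \<and> range h \<subseteq> \<real>\<^sub>\<ge>\<^sub>0 \<and>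
               (\<forall>\<^sub>F n in sequentially. \<forall>y\<in>ball x d \<inter> S. cmod (f n y) \<le> cmod (h n))"
    if x: "x \<in> S" for x
  proof -
    \<comment> \<open>Half the distance to the boundary: within \<delta> of x the exponent is still
      at most -1 - \<delta>.\<close>
    define \<delta> where "\<delta> = (Re x - a) / 2"
    have \<delta>: "\<delta> > 0" using x by (simp add: S_def \<delta>_def)
    obtain d where d: "d > 0" "\<And>y. dist y x < d \<Longrightarrow> dist (K y) (K x) < 1"
      using K[of x] x by (auto simp: S_def continuous_at_eps_delta dest!: spec[of _ "1::real"])
    define h where "h = (\<lambda>n. complex_of_real (\<bar>K x + 1\<bar> * real n powr (-1 - \<delta>)))"
    have "summable (\<lambda>n. \<bar>K x + 1\<bar> * real n powr (-1 - \<delta>))"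
      using \<delta> by (intro summable_mult) (simp add: summable_real_powr_iff)
    hence "summable h" unfolding h_def by (rule summable_of_real)
    moreover have "range h \<subseteq> \<real>\<^sub>\<ge>\<^sub>0" by (auto simp: h_def intro!: mult_nonneg_nonneg)
    moreover have le: "cmod (f n y) \<le> cmod (h n)" if y: "y \<in> ball x (min d \<delta>) \<inter> S" and n: "n > 0" for n y
    proof -
      have "\<bar>Re x - Re y\<bar> < \<delta>"
        using y abs_Re_le_cmod[of "x - y"] by (simp add: dist_norm)
      hence "Re x - Re y < \<delta>" by (simp add: abs_less_iff)
      moreover have "2 * \<delta> = Re x - a" by (simp add: \<delta>_def)
      ultimately have Re: "a - 1 - Re y \<le> -1 - \<delta>" by linarith
      have Ky: "K y \<le> \<bar>K x + 1\<bar>" using d(2)[of y] y by (auto simp: dist_commute dist_real_def)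
      have "norm (f n y) \<le> K y * real n powr (a - 1 - Re y)" using bound n y by (simp add: S_def)
      also have "\<dots> \<le> \<bar>K x + 1\<bar> * real n powr (a - 1 - Re y)" using Ky by (intro mult_right_mono) auto
      also have "\<dots> \<le> \<bar>K x + 1\<bar> * real n powr (-1 - \<delta>)"
        using Re n by (intro mult_left_mono powr_mono) auto
      finally show ?thesis by (simp add: h_def abs_mult norm_mult)
    qed
    have "\<forall>\<^sub>F n in sequentially. \<forall>y\<in>ball x (min d \<delta>) \<inter> S. cmod (f n y) \<le> cmod (h n)"
      by (rule eventually_mono[OF eventually_gt_at_top[of 0]]) (use le in blast)
    ultimately show ?thesis using d(1) \<delta> by (intro exI[of _ "min d \<delta>"] exI[of _ h]) auto
  qed
  have der: "(f n has_field_derivative deriv (f n) x) (at x)" if "x \<in> S" for n x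
    using f S that unfolding S_def by (rule holomorphic_derivI)
  obtain g g' where g: "\<forall>x\<in>S. ((\<lambda>n. f n x) sums g x) \<and> ((\<lambda>n. deriv (f n) x) sums g' x) \<and> (g has_field_derivative g' x) (at x)"
    using series_and_derivative_comparison_complex[OF S der loc] by blast
  have g_eq: "(\<Sum>n. f n x) = g x" if "x \<in> S" for x using g that by (simp add: sums_iff)
  have gd: "((\<lambda>s. \<Sum>n. f n s) has_field_derivative g' x) (at x)" if x: "x \<in> S" for x
  proof (rule has_field_derivative_transform_within_open[OF _ S x])
    show "(g has_field_derivative g' x) (at x)" using g x by blast
  qed (simp add: g_eq)
  show "(\<lambda>s. \<Sum>n. f n s) holomorphic_on {s. Re s > a}"
    using gd by (auto simp: S_def [symmetric] holomorphic_on_open[OF S])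
  show "summable (\<lambda>n. f n s)" if "Re s > a" using g that by (auto simp: S_def sums_iff)
  show "(\<lambda>n. deriv (f n) s) sums deriv (\<lambda>s. \<Sum>n. f n s) s" if "Re s > a"
    using g that DERIV_imp_deriv[OF gd[of s]] by (simp add: S_def)
qed

text \<open>
  For \<open>Re s > 1\<close> the first two terms telescope to \<open>0\<close>, leaving \<open>(s - 1) \<zeta>(s)\<close>. Sums start
  at \<open>n = 0\<close>, where \<open>0 powr z = 0\<close>.
\<close>
definition zeta_pole_removed :: "complex \<Rightarrow> complex" where
  "zeta_pole_removed s =
     (\<Sum>n. of_nat (Suc n) powr (1 - s) - of_nat n powr (1 - s) - (1 - s) * npow n s)"

text \<open>Each summand is the Taylor remainder of x powr (1 - s) at n, hence of size n powr (-1 -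
  Re s). This carries (s - 1) \<zeta>(s) across the line Re s = 1.\<close>

lemma holomorphic_zeta_pole_removed: "zeta_pole_removed holomorphic_on {s. Re s > 0}"
  unfolding zeta_pole_removed_def [abs_def]
proof (rule holomorphic_series_halfplane(1)[where K = "\<lambda>s. norm (1 - s) * norm s"])
  fix n :: nat and s :: complex assume "n > 0" "Re s > 0"
  thus "norm (of_nat (Suc n) powr (1 - s) - of_nat n powr (1 - s) - (1 - s) * npow n s)
          \<le> norm (1 - s) * norm s * real n powr (0 - 1 - Re s)"
    using norm_powr_Suc_diff_le[of n "1 - s"] by simp
qed (intro holomorphic_intros continuous_intros)+

text \<open>The residue of \<zeta> at 1. At s = 1 the linear terms vanish and the differences of
  zeroth powers are 0, except at n = 0, where 0 powr 0 = 0 leaves 1.\<close>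

lemma zeta_pole_removed_1 [simp]: "zeta_pole_removed 1 = 1"
proof -
  have "(\<lambda>n. complex_of_nat (Suc n) powr 0 - of_nat n powr 0) = (\<lambda>n. if n = 0 then 1 else 0)"
    by (auto simp: fun_eq_iff simp del: of_nat_Suc)
  thus ?thesis unfolding zeta_pole_removed_def
    using sums_unique[OF sums_single[of 0 "\<lambda>_. 1 :: complex"]] by simp
qed

section \<open>The zeta series and its derivative\<close>

definition zeta_series :: "complex \<Rightarrow> complex" where
  "zeta_series s = (\<Sum>n. npow n s)"

lemma norm_npow: "norm (npow n s) = real n powr (-Re s)"
  by (simp add: norm_of_nat_powr)

lemma abs_summable_npow: "Re s > 1 \<Longrightarrow> summable (\<lambda>n. norm (npow n s))"
  by (simp add: norm_npow summable_real_powr_iff)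

lemma zeta_series_sums: "Re s > 1 \<Longrightarrow> (\<lambda>n. npow n s) sums zeta_series s"
  unfolding zeta_series_def using summable_norm_cancel[OF abs_summable_npow] by (simp add: summable_sums)

lemma zeta_pole_removed_eq:
  assumes s: "Re s > 1"
  shows "zeta_pole_removed s = (s - 1) * zeta_series s"
proof -
  have "(\<lambda>n. norm (complex_of_nat n powr (1 - s))) \<longlonglongrightarrow> 0"
    unfolding norm_of_nat_powr using s by (intro tendsto_neg_powr filterlim_real_sequentially) auto
  hence "(\<lambda>n. complex_of_nat n powr (1 - s)) \<longlonglongrightarrow> 0" by (rule tendsto_norm_zero_cancel)
  from telescope_sums[OF this]
  have "(\<lambda>n. of_nat (Suc n) powr (1 - s) - of_nat n powr (1 - s) :: complex) sums 0" by simp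
  from sums_diff[OF this sums_mult[OF zeta_series_sums[OF s], of "1 - s"]]
  show ?thesis by (simp add: zeta_pole_removed_def sums_iff algebra_simps)
qed

lemma deriv_zeta_series_sums:
  assumes s: "Re s > 1"
  shows "(\<lambda>n. - of_real (ln (real n)) * npow n s) sums deriv zeta_series s"
    and "zeta_series field_differentiable at s"
proof -
  have hol: "npow n holomorphic_on {s. Re s > 1}" for n by (intro holomorphic_intros)
  have bound: "norm (npow n s) \<le> 1 * real n powr (1 - 1 - Re s)" for n s
    by (simp add: norm_npow)
  have "deriv (npow n) s = - of_real (ln (real n)) * npow n s" for n
  proof (cases "n = 0")
    case False
    hence eq: "npow n = (\<lambda>s. exp (- s * of_real (ln (real n))))"
      by (auto simp: fun_eq_iff powr_def Ln_of_nat)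
    have "(npow n has_field_derivative - of_real (ln (real n)) * npow n s) (at s)"
      unfolding eq by (auto intro!: derivative_eq_intros simp: fun_cong[OF eq])
    thus ?thesis by (rule DERIV_imp_deriv)
  qed auto
  thus "(\<lambda>n. - of_real (ln (real n)) * npow n s) sums deriv zeta_series s"
    using holomorphic_series_halfplane(3)[OF hol _ bound, where s = s] s
    by (simp add: zeta_series_def [abs_def])
  have "zeta_series holomorphic_on {s. Re s > 1}"
    unfolding zeta_series_def [abs_def] using holomorphic_series_halfplane(1)[OF hol _ bound] by simp
  thus "zeta_series field_differentiable at s"
    using s by (auto intro: holomorphic_on_imp_differentiable_at open_halfspace_Re_gt)
qed

section \<open>The von Mangoldt series and Dirichlet convolution\<close>

definition mangoldt_series :: "complex \<Rightarrow> complex" where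
  "mangoldt_series s = (\<Sum>n. mangoldt n * npow n s)"

lemma summable_mangoldt_powr:
  fixes x :: real
  assumes "x > 1"
  shows "summable (\<lambda>n. mangoldt n * real n powr (-x))"
proof -
  \<comment> \<open>Half of the excess of x over 1 pays for the logarithm, via ln n \<le> n powr e /
    e; the other half keeps the series convergent.\<close>
  define e where "e = (x - 1) / 2"
  have e: "e > 0" "e - x < -1" using assms by (auto simp: e_def field_simps)
  show ?thesis
  proof (rule summable_comparison_test')
    show "summable (\<lambda>n. 1 / e * real n powr (e - x))"
      using e by (intro summable_mult) (simp add: summable_real_powr_iff)
    fix n :: nat assume n: "n \<ge> 1"
    have "mangoldt n \<le> ln (real n)" using n by (intro mangoldt_le) auto
    also have "\<dots> \<le> real n powr e / e" using n e by (intro ln_powr_bound) auto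
    finally have "mangoldt n * real n powr (-x) \<le> real n powr e / e * real n powr (-x)"
      by (intro mult_right_mono) auto
    also have "\<dots> = 1 / e * real n powr (e - x)" using n by (simp add: powr_diff powr_minus field_simps)
    finally show "norm (mangoldt n * real n powr (-x)) \<le> 1 / e * real n powr (e - x)"
      using mangoldt_nonneg[of n] by (simp add: abs_mult)
  qed
qed

lemma abs_summable_mangoldt_npow:
  "Re s > 1 \<Longrightarrow> summable (\<lambda>n. norm (mangoldt n * npow n s :: complex))"
  using summable_mangoldt_powr by (simp add: norm_mult norm_npow)

lemma mangoldt_series_sums: "Re s > 1 \<Longrightarrow> (\<lambda>n. mangoldt n * npow n s) sums mangoldt_series s"
  unfolding mangoldt_series_def
  using summable_norm_cancel[OF abs_summable_mangoldt_npow] by (simp add: summable_sums)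

lemma npow_mult: "npow (m * n) s = npow m s * npow n s"
  by (simp add: powr_times_real)

text \<open>Absolute convergence lets the double series over pairs (d, m) be regrouped by the
  product n = d m. The regrouping is done over positive integers, because 0 has infinitely many
  divisors; the terms at 0 vanish anyway.\<close>

lemma dirichlet_product_sums:
  fixes f g :: "nat \<Rightarrow> complex"
  assumes f: "summable (\<lambda>n. norm (f n * npow n s))" and g: "summable (\<lambda>n. norm (g n * npow n s))"
  shows "(\<lambda>n. (\<Sum>d | d dvd n. f d * g (n div d)) * npow n s) sums
           ((\<Sum>n. f n * npow n s) * (\<Sum>n. g n * npow n s))"
proof -
  define F G where "F = (\<lambda>n. f n * npow n s)" and "G = (\<lambda>n. g n * npow n s)"
  define P where "P = {0 :: nat<..}"
  have pos: "(h has_sum (\<Sum>n. h n)) P" if "summable (\<lambda>n. norm (h n))" "h 0 = 0" for h :: "nat \<Rightarrow> complex"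
  proof -
    have "(h has_sum (\<Sum>n. h n)) UNIV"
      by (rule norm_summable_imp_has_sum[OF that(1) summable_sums[OF summable_norm_cancel[OF that(1)]]])
    also have "?this \<longleftrightarrow> (h has_sum (\<Sum>n. h n)) P"
      by (rule has_sum_cong_neutral) (use that(2) in \<open>auto simp: P_def\<close>)
    finally show ?thesis .
  qed
  have posr: "(\<lambda>n. norm (h n)) summable_on P" if "summable (\<lambda>n. norm (h n))" for h :: "nat \<Rightarrow> complex"
  proof -
    have "(\<lambda>n. norm (h n)) summable_on UNIV" using that by (subst summable_on_UNIV_nonneg_real_iff) auto
    thus ?thesis by (rule summable_on_subset) auto
  qed
  have F: "(F has_sum (\<Sum>n. F n)) P" and G: "(G has_sum (\<Sum>n. G n)) P"
    using f g by (auto intro!: pos simp: F_def G_def)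
  have "(\<lambda>x. norm (F (fst x) * G (snd x))) summable_on P \<times> P"
  proof (rule summable_on_SigmaI)
    fix d assume "d \<in> P"
    have "((\<lambda>m. norm (G m)) has_sum infsum (\<lambda>m. norm (G m)) P) P"
      using posr[OF g] by (simp add: G_def)
    from has_sum_cmult_right[OF this, of "norm (F d)"]
    show "((\<lambda>m. norm (F (fst (d, m)) * G (snd (d, m)))) has_sum norm (F d) * infsum (\<lambda>m. norm (G m)) P) P"
      by (simp add: norm_mult)
  next
    show "(\<lambda>d. norm (F d) * infsum (\<lambda>m. norm (G m)) P) summable_on P"
      using posr[OF f] by (intro summable_on_cmult_left) (simp add: F_def)
  qed auto
  hence "(\<lambda>x. F (fst x) * G (snd x)) summable_on P \<times> P" by (rule abs_summable_summable)
  hence "((\<lambda>x. F (fst x) * G (snd x)) has_sum (\<Sum>n. F n) * (\<Sum>n. G n)) (P \<times> P)"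
    using has_sum_cmult_right[OF G] has_sum_cmult_left[OF F] by (intro has_sum_SigmaI) auto
  also have "?this \<longleftrightarrow> ((\<lambda>x. F (snd x) * G (fst x div snd x)) has_sum (\<Sum>n. F n) * (\<Sum>n. G n))
                (Sigma P (\<lambda>n. {d. d dvd n}))"
    by (rule has_sum_reindex_bij_witness[of _ "\<lambda>(n, d). (d, n div d)" "\<lambda>(d, m). (d * m, d)"])
       (auto simp: P_def)
  finally have "((\<lambda>n. \<Sum>d | d dvd n. F d * G (n div d)) has_sum (\<Sum>n. F n) * (\<Sum>n. G n)) P"
    by (rule has_sum_SigmaD) (auto simp: P_def intro!: has_sum_finiteI)
  also have "?this \<longleftrightarrow> ((\<lambda>n. (\<Sum>d | d dvd n. f d * g (n div d)) * npow n s) has_sum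
                 (\<Sum>n. F n) * (\<Sum>n. G n)) UNIV"
  proof (rule has_sum_cong_neutral)
    fix n assume "n \<in> P \<inter> UNIV"
    show "(\<Sum>d | d dvd n. F d * G (n div d)) = (\<Sum>d | d dvd n. f d * g (n div d)) * npow n s"
      unfolding sum_distrib_right
    proof (rule sum.cong)
      fix d assume "d \<in> {d. d dvd n}"
      hence "npow n s = npow d s * npow (n div d) s" by (subst npow_mult [symmetric]) auto
      thus "F d * G (n div d) = f d * g (n div d) * npow n s" by (simp add: F_def G_def)
    qed auto
  qed (auto simp: P_def)
  finally show ?thesis unfolding F_def G_def by (rule has_sum_imp_sums)
qed

lemma deriv_zeta_series:
  assumes s: "Re s > 1"
  shows "deriv zeta_series s = - mangoldt_series s * zeta_series s"
proof -
  have "(\<lambda>n. (\<Sum>d | d dvd n. mangoldt d * 1) * npow n s) sums (mangoldt_series s * zeta_series s)"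
    using dirichlet_product_sums[of mangoldt s "\<lambda>_. 1"] abs_summable_mangoldt_npow[OF s]
      abs_summable_npow[OF s] by (simp add: mangoldt_series_def zeta_series_def)
  moreover have "(\<Sum>d | d dvd n. mangoldt d * 1) * npow n s = of_real (ln (real n)) * npow n s" for n
    by (cases "n = 0") (simp_all add: mangoldt_sum)
  ultimately have "(\<lambda>n. of_real (ln (real n)) * npow n s) sums (mangoldt_series s * zeta_series s)" by (simp only:)
  from sums_minus[OF this] show ?thesis using deriv_zeta_series_sums(1)[OF s]
    by (auto intro: sums_unique2)
qed

text \<open>Stated as a product rather than a quotient, because it enters the very proof that
  \<open>zeta_pole_removed\<close> has no zeros.\<close>

lemma deriv_zeta_pole_removed:
  assumes s: "Re s > 1"
  shows "deriv zeta_pole_removed s = zeta_pole_removed s * (1 / (s - 1) - mangoldt_series s)"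
proof -
  have "((\<lambda>s. (s - 1) * zeta_series s) has_field_derivative
          (zeta_series s + (s - 1) * deriv zeta_series s)) (at s)"
    using deriv_zeta_series_sums(2)[OF s]
    by (auto intro!: derivative_eq_intros simp: field_differentiable_derivI)
  hence "(zeta_pole_removed has_field_derivative
          (zeta_series s + (s - 1) * deriv zeta_series s)) (at s)"
    by (rule has_field_derivative_transform_within_open[of _ _ _ "{s. Re s > 1}"])
       (use s in \<open>auto simp: open_halfspace_Re_gt zeta_pole_removed_eq\<close>)
  hence "deriv zeta_pole_removed s = zeta_series s + (s - 1) * deriv zeta_series s"
    by (rule DERIV_imp_deriv)
  moreover have "s - 1 \<noteq> 0" using s by auto
  hence "(s - 1) * (1 / (s - 1) - mangoldt_series s) = 1 - (s - 1) * mangoldt_series s"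
    by (simp add: right_diff_distrib)
  hence "(s - 1) * zeta_series s * (1 / (s - 1) - mangoldt_series s)
           = zeta_series s * (1 - (s - 1) * mangoldt_series s)"
    by (metis mult.commute mult.left_commute)
  ultimately show ?thesis
    using s by (simp add: zeta_pole_removed_eq deriv_zeta_series algebra_simps)
qed

section \<open>Non-vanishing on the line of convergence\<close>

text \<open>The number m is the order of the zero at z: writing f(w) = (w - z)^m g(w) with g(z)
  \<noteq> 0 gives (w - z) f'/f = m + (w - z) g'/g. The limit is taken along a horizontal ray from
  the right, so that on the line Re s = 1 only points of convergence of the Dirichlet series
  occur.\<close>

lemma logarithmic_derivative_limit:
  assumes f: "f holomorphic_on S" "open S" "connected S" "z \<in> S" and "\<exists>w\<in>S. f w \<noteq> 0"
  obtains m :: nat where "f z = 0 \<longleftrightarrow> m > 0" "eventually (\<lambda>x::real. f (z + of_real x) \<noteq> 0) (at_right 0)"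
    "((\<lambda>x::real. of_real x * (deriv f (z + of_real x) / f (z + of_real x))) \<longlongrightarrow> of_nat m) (at_right 0)"
proof -
  define m where "m = nat (zorder f z)"
  define g where "g = zor_poly f z"
  from zorder_exist_zero[OF assms] obtain r where
    m: "if f z = 0 then zorder f z > 0 else zorder f z = 0"
    and r: "r > 0" "g holomorphic_on cball z r"
      "\<And>w. w \<in> cball z r \<Longrightarrow> f w = g w * (w - z) ^ m" "\<And>w. w \<in> cball z r \<Longrightarrow> g w \<noteq> 0"
    unfolding m_def g_def by blast
  have g: "g holomorphic_on ball z r" using r(2) by (rule holomorphic_on_subset) auto
  have in_ball: "z + of_real x \<in> ball z r" if "x > 0" "x < r" for x :: real
    using that by (simp add: dist_norm)
  have eq: "of_real x * (deriv f w / f w) = of_real x * (deriv g w / g w) + of_nat m" and nz: "f w \<noteq> 0"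
    if x: "x > 0" "x < r" and w: "w = z + of_real x" for x :: real and w
  proof -
    have wb: "w \<in> ball z r" using in_ball x w by simp
    have gw: "g w \<noteq> 0" using r(4) wb by simp
    have wz: "w - z \<noteq> 0" "w - z = of_real x" using x w by auto
    show "f w \<noteq> 0" using r(3)[of w] wb gw wz by simp
    have "((\<lambda>w. g w * (w - z) ^ m) has_field_derivative
             (deriv g w * (w - z) ^ m + g w * (of_nat m * (w - z) ^ (m - 1)))) (at w)"
      using holomorphic_derivI[OF g open_ball wb] by (auto intro!: derivative_eq_intros)
    hence "(f has_field_derivative
             (deriv g w * (w - z) ^ m + g w * (of_nat m * (w - z) ^ (m - 1)))) (at w)"
      by (rule has_field_derivative_transform_within_open[OF _ open_ball wb]) (use r(3) in auto)
    hence "deriv f w = deriv g w * (w - z) ^ m + g w * (of_nat m * (w - z) ^ (m - 1))"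
      by (rule DERIV_imp_deriv)
    \<comment> \<open>For m = 0 the exponent m - 1 is truncated to 0, but the factor m removes that
      term.\<close>
    moreover have "d * (a * d ^ m + b * (of_nat m * d ^ (m - 1))) = (d * a + b * of_nat m) * d ^ m"
      for a b d :: complex by (cases m) (simp_all add: algebra_simps)
    ultimately have "(w - z) * deriv f w = ((w - z) * deriv g w + g w * of_nat m) * (w - z) ^ m"
      by (simp only:)
    moreover have "f w = g w * (w - z) ^ m" using r(3) wb by simp
    ultimately have "(w - z) * (deriv f w / f w) = ((w - z) * deriv g w + g w * of_nat m) / g w"
      using wz(1) by simp
    thus "of_real x * (deriv f w / f w) = of_real x * (deriv g w / g w) + of_nat m"
      using gw by (simp add: wz(2) add_divide_distrib)
  qed
  have ev: "eventually (\<lambda>x::real. x > 0 \<and> x < r) (at_right 0)"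
    using eventually_at_right_real[OF r(1)] by simp
  have "isCont (\<lambda>w. deriv g w / g w) z"
    using g r by (intro continuous_intros holomorphic_on_imp_continuous_on
        continuous_on_interior[of "ball z r"] holomorphic_deriv) auto
  moreover have "((\<lambda>x::real. z + of_real x) \<longlongrightarrow> z + of_real 0) (at_right 0)"
    by (intro tendsto_intros)
  ultimately have lim: "((\<lambda>x::real. deriv g (z + of_real x) / g (z + of_real x)) \<longlongrightarrow> deriv g z / g z) (at_right 0)"
    using isCont_tendsto_compose[of z "\<lambda>w. deriv g w / g w"] by simp
  have "((\<lambda>x::real. complex_of_real x) \<longlongrightarrow> of_real 0) (at_right 0)" by (intro tendsto_intros)
  from tendsto_add[OF tendsto_mult[OF this lim] tendsto_const[of "of_nat m"]]
  have "((\<lambda>x::real. of_real x * (deriv g (z + of_real x) / g (z + of_real x)) + of_nat m)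
            \<longlongrightarrow> of_nat m) (at_right 0)" by simp
  hence "((\<lambda>x::real. of_real x * (deriv f (z + of_real x) / f (z + of_real x))) \<longlongrightarrow> of_nat m) (at_right 0)"
  proof (rule Lim_transform_eventually)
    show "\<forall>\<^sub>F x::real in at_right 0.
        of_real x * (deriv g (z + of_real x) / g (z + of_real x)) + of_nat m =
        of_real x * (deriv f (z + of_real x) / f (z + of_real x))"
      using ev
    proof eventually_elim
      case (elim x)
      thus ?case using eq[of x "z + of_real x"] by simp
    qed
  qed
  moreover have "eventually (\<lambda>x::real. f (z + of_real x) \<noteq> 0) (at_right 0)"
    using ev by eventually_elim (use nz in auto)
  moreover have "f z = 0 \<longleftrightarrow> m > 0" using m by (auto simp: m_def split: if_splits)
  ultimately show ?thesis using that by blast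
qed

text \<open>The series is 1/(s - 1) minus the logarithmic derivative of (s - 1) \<zeta>(s).
  Multiplied by x, the first part tends to 1 at z = 1 and to 0 elsewhere, the second to the order of
  the zero.\<close>

lemma mangoldt_series_limit:
  assumes z: "Re z \<ge> 1"
  obtains m :: nat where "zeta_pole_removed z = 0 \<longleftrightarrow> m > 0"
    "((\<lambda>x::real. of_real x * mangoldt_series (z + of_real x)) \<longlongrightarrow>
        (if z = 1 then 1 else 0) - of_nat m) (at_right 0)"
proof -
  obtain m :: nat where m: "zeta_pole_removed z = 0 \<longleftrightarrow> m > 0"
    "eventually (\<lambda>x::real. zeta_pole_removed (z + of_real x) \<noteq> 0) (at_right 0)"
    "((\<lambda>x::real. of_real x * (deriv zeta_pole_removed (z + of_real x) / zeta_pole_removed (z + of_real x)))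
        \<longlongrightarrow> of_nat m) (at_right 0)"
  proof (rule logarithmic_derivative_limit[OF holomorphic_zeta_pole_removed])
    show "\<exists>w\<in>{s. 0 < Re s}. zeta_pole_removed w \<noteq> 0" by (intro bexI[of _ 1]) auto
  qed (use z in \<open>auto simp: open_halfspace_Re_gt convex_connected convex_halfspace_Re_gt\<close>)
  have pole: "((\<lambda>x::real. of_real x * (1 / (z + of_real x - 1))) \<longlongrightarrow> (if z = 1 then 1 else 0)) (at_right 0)"
  proof (cases "z = 1")
    case True
    have "((\<lambda>x::real. 1 :: complex) \<longlongrightarrow> 1) (at_right 0)" by simp
    hence "((\<lambda>x::real. of_real x * (1 / (z + of_real x - 1))) \<longlongrightarrow> (1 :: complex)) (at_right 0)"
      by (rule Lim_transform_eventually)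
         (use eventually_at_right_less[of 0] True in \<open>auto elim!: eventually_mono\<close>)
    thus ?thesis using True by simp
  next
    case False
    have "((\<lambda>x::real. of_real x * (1 / (z + of_real x - 1))) \<longlongrightarrow> of_real 0 * (1 / (z + of_real 0 - 1))) (at_right 0)"
      using False by (intro tendsto_intros) auto
    thus ?thesis using False by simp
  qed
  have "((\<lambda>x::real. of_real x * mangoldt_series (z + of_real x)) \<longlongrightarrow>
          (if z = 1 then 1 else 0) - of_nat m) (at_right 0)"
  proof (rule Lim_transform_eventually[OF tendsto_diff[OF pole m(3)]])
    show "\<forall>\<^sub>F x::real in at_right 0. of_real x * (1 / (z + of_real x - 1)) -
        of_real x * (deriv zeta_pole_removed (z + of_real x) / zeta_pole_removed (z + of_real x)) =
        of_real x * mangoldt_series (z + of_real x)"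
      using m(2) eventually_at_right_less[of 0]
    proof eventually_elim
      case (elim x)
      have "Re (z + of_real x) > 1" using z elim by simp
      from deriv_zeta_pole_removed[OF this] elim(1)
      have "deriv zeta_pole_removed (z + of_real x) / zeta_pole_removed (z + of_real x)
              = 1 / (z + of_real x - 1) - mangoldt_series (z + of_real x)" by simp
      thus ?case by (simp only: right_diff_distrib) simp
    qed
  qed
  thus ?thesis using that m(1) by blast
qed

text \<open>Termwise: with u = t ln n, the n-th term has real part \<Lambda>(n) n powr (-x) times 3
  + 4 cos u + cos 2u = 2 (1 + cos u)^2.\<close>

lemma Re_mangoldt_series_341:
  assumes "x > 1"
  shows "Re (3 * mangoldt_series (of_real x) + 4 * mangoldt_series (Complex x t)
           + mangoldt_series (Complex x (2 * t))) \<ge> 0"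
proof -
  define h where "h = (\<lambda>n. 3 * (mangoldt n * npow n (of_real x)) + 4 * (mangoldt n * npow n (Complex x t))
           + mangoldt n * npow n (Complex x (2 * t)))"
  have "h sums (3 * mangoldt_series (of_real x) + 4 * mangoldt_series (Complex x t)
           + mangoldt_series (Complex x (2 * t)))"
    unfolding h_def using assms by (intro sums_add sums_mult mangoldt_series_sums) auto
  hence "(\<lambda>n. Re (h n)) sums Re (3 * mangoldt_series (of_real x) + 4 * mangoldt_series (Complex x t)
           + mangoldt_series (Complex x (2 * t)))" by (rule sums_Re)
  moreover have "Re (h n) \<ge> 0" for n
  proof (cases "n = 0")
    case False
    define c where "c = cos (t * ln (real n))"
    have npow: "npow n (Complex a b) = of_real (real n powr (-a)) * cis (- (b * ln (real n)))" for a b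
    proof -
      have "npow n (Complex a b) = exp (- Complex a b * of_real (ln (real n)))"
        using False by (simp add: powr_def Ln_of_nat)
      also have "- Complex a b * of_real (ln (real n)) = Complex (-a * ln (real n)) (- (b * ln (real n)))"
        by (simp add: complex_eq_iff)
      also have "exp \<dots> = of_real (exp (-a * ln (real n))) * cis (- (b * ln (real n)))"
        by (simp add: exp_eq_polar)
      finally show ?thesis using False by (simp add: powr_def)
    qed
    have x: "complex_of_real x = Complex x 0" by (simp add: complex_eq_iff)
    have m: "mangoldt n = complex_of_real (mangoldt n)" by simp
    have "Re (h n) = mangoldt n * (real n powr (-x) * (3 + 4 * c + cos (2 * (t * ln (real n)))))"
      unfolding h_def x npow c_def m
      by (simp add: algebra_simps del: of_real_mangoldt)
    also have "cos (2 * (t * ln (real n))) = 2 * c ^ 2 - 1" by (simp add: c_def cos_double_cos)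
    also have "3 + 4 * c + (2 * c ^ 2 - 1) = 2 * (1 + c) ^ 2" by (simp add: power2_eq_square algebra_simps)
    finally show ?thesis using mangoldt_nonneg[of n] by simp
  qed (simp add: h_def)
  ultimately show ?thesis by (metis sums_le sums_zero)
qed

text \<open>Multiplying the 3-4-1 inequality by x and letting x tend to 0 from the right leaves 3 (p
  - m0) - 4 m1 - m2 \<ge> 0, where p \<le> 1 comes from the pole and m0, m1, m2 are orders of zeros.
  Hence 4 m1 \<le> 3 and m1 = 0. The point 1 is separate, as there all three series would meet the
  pole.\<close>

lemma zeta_pole_removed_nonzero:
  assumes z: "Re z \<ge> 1"
  shows "zeta_pole_removed z \<noteq> 0"
proof (cases "z = 1")
  case False
  define t where "t = Im z"
  have z_eq: "z = Complex (Re z) t" by (simp add: t_def)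
  define z2 where "z2 = Complex (Re z) (2 * t)"
  have z2: "z2 \<noteq> 1" using False by (auto simp: z2_def t_def complex_eq_iff)
  obtain m0 :: nat where m0: "((\<lambda>x::real. of_real x * mangoldt_series (of_real (Re z) + of_real x)) \<longlongrightarrow>
        (if of_real (Re z) = (1 :: complex) then 1 else 0) - of_nat m0) (at_right 0)"
    by (rule mangoldt_series_limit[of "of_real (Re z)"]) (use z in simp)
  obtain m1 :: nat where m1: "zeta_pole_removed z = 0 \<longleftrightarrow> m1 > 0"
    "((\<lambda>x::real. of_real x * mangoldt_series (z + of_real x)) \<longlongrightarrow> - of_nat m1) (at_right 0)"
    by (rule mangoldt_series_limit[OF z, unfolded if_not_P[OF False] diff_0])
  have "Re z2 \<ge> 1" using z by (simp add: z2_def)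
  then obtain m2 :: nat where m2:
    "((\<lambda>x::real. of_real x * mangoldt_series (z2 + of_real x)) \<longlongrightarrow> - of_nat m2) (at_right 0)"
    by (rule mangoldt_series_limit[of z2, unfolded if_not_P[OF z2] diff_0])
  have lim: "((\<lambda>x::real. Re (3 * (of_real x * mangoldt_series (of_real (Re z) + of_real x))
            + 4 * (of_real x * mangoldt_series (z + of_real x))
            + of_real x * mangoldt_series (z2 + of_real x))) \<longlongrightarrow>
           Re (3 * ((if of_real (Re z) = (1 :: complex) then 1 else 0) - of_nat m0)
            + 4 * (- of_nat m1) + - of_nat m2)) (at_right 0)"
    by (intro tendsto_intros m0 m1 m2)
  have "Re (3 * ((if of_real (Re z) = (1 :: complex) then 1 else 0) - of_nat m0)
            + 4 * (- of_nat m1) + - of_nat m2) \<ge> 0"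
  proof (rule tendsto_lowerbound[OF lim])
    show "\<forall>\<^sub>F x::real in at_right 0. 0 \<le> Re (3 * (of_real x * mangoldt_series (of_real (Re z) + of_real x))
            + 4 * (of_real x * mangoldt_series (z + of_real x))
            + of_real x * mangoldt_series (z2 + of_real x))"
      using eventually_at_right_less[of 0]
    proof eventually_elim
      case (elim x)
      have eqs: "z + of_real x = Complex (Re z + x) t" "z2 + of_real x = Complex (Re z + x) (2 * t)"
        by (simp_all add: z2_def t_def complex_eq_iff)
      have "Re z + x > 1" using elim z by simp
      from mult_nonneg_nonneg[OF less_imp_le[OF elim] Re_mangoldt_series_341[OF this, of t]]
      show ?case unfolding eqs by (simp add: algebra_simps)
    qed
  qed simp
  hence "real m1 * 4 \<le> 3" by (auto split: if_splits)
  hence "m1 = 0" by linarith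
  thus ?thesis using m1 by simp
qed simp

text \<open>With Z(s) = (s - 1) \<zeta>(s) this is -\<zeta>'/\<zeta> - \<zeta> after the poles 1/(s
  - 1) of both have been cancelled. As Z(1) = 1, the last quotient is a difference quotient of Z,
  and its removable singularity is filled by the derivative.\<close>

definition mangoldt_minus_zeta :: "complex \<Rightarrow> complex" where
  "mangoldt_minus_zeta s = - deriv zeta_pole_removed s / zeta_pole_removed s -
     (if s = 1 then deriv zeta_pole_removed 1 else (zeta_pole_removed s - 1) / (s - 1))"

lemma mangoldt_minus_zeta_eq:
  assumes s: "Re s > 1"
  shows "mangoldt_series s - zeta_series s = mangoldt_minus_zeta s"
proof -
  have s1: "s - 1 \<noteq> 0" using s by auto
  have "deriv zeta_pole_removed s / zeta_pole_removed s = 1 / (s - 1) - mangoldt_series s"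
    using deriv_zeta_pole_removed[OF s] zeta_pole_removed_nonzero[of s] s by simp
  moreover have "(zeta_pole_removed s - 1) / (s - 1) = zeta_series s - 1 / (s - 1)"
    using s1 by (simp add: zeta_pole_removed_eq[OF s] diff_divide_distrib)
  ultimately show ?thesis using s1 by (simp add: mangoldt_minus_zeta_def)
qed

lemma analytic_mangoldt_minus_zeta: "mangoldt_minus_zeta analytic_on {s. Re s \<ge> 1}"
proof -
  define H where "H = {s :: complex. Re s > 0}"
  have H: "open H" by (simp add: H_def open_halfspace_Re_gt)
  have Z: "zeta_pole_removed holomorphic_on H" using holomorphic_zeta_pole_removed by (simp add: H_def)
  have ana: "zeta_pole_removed analytic_on {s. Re s \<ge> 1}"
    "deriv zeta_pole_removed analytic_on {s. Re s \<ge> 1}"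
    using Z holomorphic_deriv[OF Z H] H
    by (auto simp: analytic_on_holomorphic H_def intro!: exI[of _ H])
  have d1: "deriv (\<lambda>s. zeta_pole_removed s - 1) 1 = deriv zeta_pole_removed 1"
    by (rule DERIV_imp_deriv) (auto intro!: derivative_eq_intros holomorphic_derivI[OF Z H] simp: H_def)
  have "(\<lambda>s. if s = 1 then deriv zeta_pole_removed 1 else (zeta_pole_removed s - 1) / (s - 1)) holomorphic_on H"
    by (rule pole_theorem_open_0[of "\<lambda>s. zeta_pole_removed s - 1" _ 1])
       (use H d1 in \<open>auto intro!: holomorphic_intros Z\<close>)
  hence "(\<lambda>s. if s = 1 then deriv zeta_pole_removed 1 else (zeta_pole_removed s - 1) / (s - 1))
           analytic_on {s. Re s \<ge> 1}"
    using H by (auto simp: analytic_on_holomorphic H_def)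
  thus ?thesis unfolding mangoldt_minus_zeta_def [abs_def]
    by (intro analytic_intros ana) (use zeta_pole_removed_nonzero in auto)
qed

section \<open>Asymptotics of the Chebyshev function\<close>

definition chebyshev_psi :: "nat \<Rightarrow> real" where
  "chebyshev_psi n = (\<Sum>k\<le>n. mangoldt k)"

lemma chebyshev_psi_mono: "m \<le> n \<Longrightarrow> chebyshev_psi m \<le> chebyshev_psi n"
  unfolding chebyshev_psi_def by (intro sum_mono2) (auto simp: mangoldt_nonneg)

lemma chebyshev_psi_nonneg: "chebyshev_psi n \<ge> 0"
  unfolding chebyshev_psi_def by (intro sum_nonneg) (auto simp: mangoldt_nonneg)

lemma chebyshev_psi_0 [simp]: "chebyshev_psi 0 = 0"
  by (simp add: chebyshev_psi_def)

lemma chebyshev_psi_Suc: "chebyshev_psi (Suc n) = chebyshev_psi n + mangoldt (Suc n)"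
  by (simp add: chebyshev_psi_def)

text \<open>Legendre's formula, from ln m being the sum of \<Lambda> over the divisors of m. The
  free upper limit N lets ln (2n)! and ln n! be written over the same range.\<close>

lemma ln_fact_eq_sum_mangoldt:
  assumes "n \<le> N"
  shows "ln (fact n) = (\<Sum>d\<in>{1..N}. mangoldt d * real (n div d))"
  using assms
proof (induction n)
  case (Suc n)
  have "ln (fact (Suc n)) = ln (real (Suc n)) + ln (fact n)"
    by (simp only: fact_Suc) (subst ln_mult, auto)
  also have "ln (real (Suc n)) = (\<Sum>d | d dvd Suc n. mangoldt d)"
    by (subst mangoldt_sum) auto
  also have "{d. d dvd Suc n} = {d \<in> {1..N}. d dvd Suc n}"
  proof (intro equalityI subsetI)
    fix d assume "d \<in> {d. d dvd Suc n}"
    hence d: "d dvd Suc n" by simp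
    show "d \<in> {d \<in> {1..N}. d dvd Suc n}"
      using d dvd_pos_nat[OF _ d] dvd_imp_le[OF d] Suc.prems by auto
  qed auto
  also have "(\<Sum>d\<in>\<dots>. mangoldt d) = (\<Sum>d\<in>{1..N}. mangoldt d * (if d dvd Suc n then 1 else 0))"
    by (subst sum.inter_filter) (auto intro!: sum.cong)
  also have "ln (fact n) = (\<Sum>d\<in>{1..N}. mangoldt d * real (n div d))" using Suc by simp
  also have "(\<Sum>d\<in>{1..N}. mangoldt d * (if d dvd Suc n then 1 else 0)) + \<dots> =
      (\<Sum>d\<in>{1..N}. mangoldt d * real (Suc n div d))"
    unfolding sum.distrib [symmetric]
    by (intro sum.cong) (auto simp: div_Suc dvd_eq_mod_eq_0 algebra_simps)
  finally show ?case .
qed auto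

text \<open>In the logarithm of the central binomial coefficient, \<Lambda>(d) has the coefficient
  \<lfloor>2n/d\<rfloor> - 2 \<lfloor>n/d\<rfloor>, which is nonnegative and equals 1 for n < d
  \<le> 2n. The binomial coefficient is at most 4^n.\<close>

lemma chebyshev_psi_double_le: "chebyshev_psi (2 * n) - chebyshev_psi n \<le> real n * ln 4"
proof -
  have "chebyshev_psi (2 * n) - chebyshev_psi n = (\<Sum>d\<in>{n<..2*n}. mangoldt d)"
  proof -
    have "{..2*n} = {..n} \<union> {n<..2*n}" by auto
    thus ?thesis unfolding chebyshev_psi_def by (simp only:) (subst sum.union_disjoint, auto)
  qed
  also have "\<dots> \<le> (\<Sum>d\<in>{n<..2*n}. mangoldt d * (real (2 * n div d) - 2 * real (n div d)))"
  proof (rule sum_mono)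
    fix d assume d: "d \<in> {n<..2*n}"
    hence "2 * n div d \<ge> 1" using div_le_mono[of d "2 * n" d] by simp
    hence "real (2 * n div d) - 2 * real (n div d) \<ge> 1" using d by simp
    from mult_left_mono[OF this mangoldt_nonneg[of d]]
    show "mangoldt d \<le> mangoldt d * (real (2 * n div d) - 2 * real (n div d))" by simp
  qed
  also have "\<dots> \<le> (\<Sum>d\<in>{1..2*n}. mangoldt d * (real (2 * n div d) - 2 * real (n div d)))"
  proof (rule sum_mono2)
    fix d assume "d \<in> {1..2*n} - {n<..2*n}"
    have "2 * (n div d) \<le> 2 * n div d"
    proof (cases "d = 0")
      case False
      have "2 * (n div d) * d \<le> 2 * n" by simp
      thus ?thesis using False by (simp add: less_eq_div_iff_mult_less_eq)
    qed auto
    hence "2 * real (n div d) \<le> real (2 * n div d)" by linarith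
    thus "0 \<le> mangoldt d * (real (2 * n div d) - 2 * real (n div d))"
      by (intro mult_nonneg_nonneg mangoldt_nonneg) simp
  qed auto
  also have "\<dots> = (\<Sum>d\<in>{1..2*n}. mangoldt d * real (2 * n div d))
                    - 2 * (\<Sum>d\<in>{1..2*n}. mangoldt d * real (n div d))"
    by (simp only: right_diff_distrib sum_subtractf sum_distrib_left mult.left_commute)
  also have "\<dots> = ln (fact (2 * n)) - 2 * ln (fact n)"
    by (subst (1 2) ln_fact_eq_sum_mangoldt[of _ "2 * n"]) auto
  also have "\<dots> = ln (real ((2 * n) choose n))"
  proof -
    have "real ((2 * n) choose n) = fact (2 * n) / (fact n * fact n)"
      by (simp add: binomial_fact)
    thus ?thesis by (simp add: ln_div ln_mult)
  qed
  also have "\<dots> \<le> ln (real (4 ^ n))"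
  proof (subst ln_le_cancel_iff)
    have "(2 * n) choose n \<le> (\<Sum>k\<le>2*n. (2 * n) choose k)" by (rule member_le_sum) auto
    also have "\<dots> = 4 ^ n" by (simp add: choose_row_sum power_mult)
    finally show "real ((2 * n) choose n) \<le> real (4 ^ n)" by linarith
  qed auto
  also have "\<dots> = real n * ln 4" by (simp add: ln_realpow)
  finally show ?thesis .
qed

text \<open>Halving: with m = n div 2, the bound at m and ln 4 \<le> 2 give at most 4m + 2m at 2m.
  For odd n the extra term is at most n - 1 = 2m, and 8m still suffices.\<close>

lemma chebyshev_psi_le: "chebyshev_psi n \<le> 4 * real n"
proof (induction n rule: less_induct)
  case (less n)
  have "ln 2 \<le> (1 :: real)" using ln_le_minus_one[of "2::real"] by simp
  moreover have "ln 4 = 2 * ln (2::real)" using ln_realpow[of 2 2] by simp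
  ultimately have ln4: "ln 4 \<le> (2::real)" by simp
  define m where "m = n div 2"
  show ?case
  proof (cases "n = 0")
    case False
    hence "m < n" by (simp add: m_def)
    hence "chebyshev_psi m \<le> 4 * real m" by (rule less.IH)
    moreover have "real m * ln 4 \<le> real m * 2" using ln4 by (intro mult_left_mono) auto
    ultimately have *: "chebyshev_psi (2 * m) \<le> 6 * real m" using chebyshev_psi_double_le[of m] by linarith
    show ?thesis
    proof (cases "even n")
      case True
      hence "n = 2 * m" by (simp add: m_def)
      thus ?thesis using * by simp
    next
      case odd: False
      hence n: "n = Suc (2 * m)" by (simp add: m_def)
      have "mangoldt n \<le> ln (real n)" using False by (intro mangoldt_le) auto
      also have "\<dots> \<le> real n - 1" using False by (intro ln_le_minus_one) auto
      also have "\<dots> = 2 * real m" by (simp add: n)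
      finally show ?thesis using * chebyshev_psi_Suc[of "2 * m"] by (simp add: n)
    qed
  qed auto
qed

text \<open>If \<psi>(N) \<ge> (1 + e) N, monotonicity keeps \<psi>(n) - n \<ge> e N / 2 for the
  next k indices, where k is about e N / 2; if \<psi>(N) \<le> (1 - e) N, the mirror image holds for
  the k indices before N. Either block contradicts Cauchy's criterion.\<close>

lemma tendsto_one_if_summable_psi:
  fixes \<psi> :: "nat \<Rightarrow> real"
  assumes mono: "\<And>m n. m \<le> n \<Longrightarrow> \<psi> m \<le> \<psi> n"
    and summable: "summable (\<lambda>n. (\<psi> n - real n) / real n ^ 2)"
  shows "(\<lambda>n. \<psi> n / real n) \<longlonglongrightarrow> 1"
proof (rule tendstoI)
  fix e0 :: real assume e0: "e0 > 0"
  define e where "e = min e0 1"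
  have e: "e > 0" "e \<le> 1" "e \<le> e0" using e0 by (auto simp: e_def)
  define g where "g = (\<lambda>n. (\<psi> n - real n) / real n ^ 2)"
  have "e ^ 2 / 32 > 0" using e by simp
  then obtain M where M: "\<And>m n. m \<ge> M \<Longrightarrow> norm (sum g {m..<n}) < e ^ 2 / 32"
    using summable unfolding g_def [symmetric] summable_Cauchy by blast
  \<comment> \<open>The part 4/e gives e N / 2 \<ge> 2, so rounding down to k loses at most half.
    The part 2 M, with k \<le> N/2, keeps the block below N above M.\<close>
  define N0 where "N0 = nat \<lceil>4 / e\<rceil> + 2 * M + 1"
  show "\<forall>\<^sub>F n in sequentially. dist (\<psi> n / real n) 1 < e0"
    using eventually_ge_at_top[of N0]
  proof eventually_elim
    case (elim N)
    have N: "N > 0" "N \<ge> 2 * M" using elim by (auto simp: N0_def)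
    have "real N \<ge> 4 / e" using elim unfolding N0_def by linarith
    hence eN: "e * real N \<ge> 4" using e by (simp add: field_simps)
    define k where "k = nat \<lfloor>e * real N / 2\<rfloor>"
    have k: "real k \<le> e * real N / 2" "real k \<ge> e * real N / 4"
      using eN unfolding k_def by linarith+
    have eN1: "e * real N \<le> real N" using e N by simp
    have kN: "2 * k \<le> N" using k(1) eN1 by linarith
    have "\<psi> N / real N < 1 + e"
    proof (rule ccontr)
      assume "\<not> ?thesis"
      hence *: "\<psi> N \<ge> real N + e * real N" using N by (simp add: field_simps)
      \<comment> \<open>At least e N / 4 indices, each contributing at least (e N / 2) / (2 N)^2 = e
        / (8 N), give the constant 32.\<close>
      have "e ^ 2 / 32 \<le> real k * (e / (8 * real N))"
      proof -
        have "e ^ 2 / 32 = (e * real N / 4) * (e / (8 * real N))" using N by (simp add: power2_eq_square)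
        also have "\<dots> \<le> real k * (e / (8 * real N))" using k e by (intro mult_right_mono) auto
        finally show ?thesis .
      qed
      also have "\<dots> = (\<Sum>n\<in>{N..<N+k}. e / (8 * real N))" by simp
      also have "\<dots> \<le> sum g {N..<N+k}"
      proof (rule sum_mono)
        fix n assume n: "n \<in> {N..<N+k}"
        have nN: "real n \<le> 2 * real N" using n kN by auto
        have "\<psi> n \<ge> \<psi> N" using n by (intro mono) auto
        moreover have "real n \<le> real N + e * real N / 2" using n k(1) by auto
        ultimately have 1: "\<psi> n - real n \<ge> e * real N / 2" using * by linarith
        have "real n ^ 2 \<le> (2 * real N) ^ 2" using nN by (intro power_mono) auto
        hence 2: "real n ^ 2 \<le> 4 * real N ^ 2" by (simp add: power_mult_distrib)
        have n0: "n > 0" using n N by auto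
        have 3: "0 \<le> e * real N / 2" and 4: "0 < real n ^ 2" using e n0 by simp_all
        have "e / (8 * real N) = (e * real N / 2) / (4 * real N ^ 2)"
          using N by (simp add: power2_eq_square)
        also have "\<dots> \<le> (\<psi> n - real n) / real n ^ 2"
          by (rule frac_le[OF order.trans[OF 3 1] 1 4 2])
        finally show "e / (8 * real N) \<le> g n" by (simp add: g_def)
      qed
      also have "\<dots> \<le> norm (sum g {N..<N+k})" by simp
      also have "\<dots> < e ^ 2 / 32" using N by (intro M) auto
      finally show False by simp
    qed
    moreover have "\<psi> N / real N > 1 - e"
    proof (rule ccontr)
      assume "\<not> ?thesis"
      hence *: "\<psi> N \<le> real N - e * real N" using N by (simp add: field_simps)
      have "e ^ 2 / 32 \<le> real k * (e / (8 * real N))"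
      proof -
        have "e ^ 2 / 32 = (e * real N / 4) * (e / (8 * real N))" using N by (simp add: power2_eq_square)
        also have "\<dots> \<le> real k * (e / (8 * real N))" using k e by (intro mult_right_mono) auto
        finally show ?thesis .
      qed
      also have "\<dots> = (\<Sum>n\<in>{N-k..<N}. e / (8 * real N))" using kN by simp
      also have "\<dots> \<le> (\<Sum>n\<in>{N-k..<N}. - g n)"
      proof (rule sum_mono)
        fix n assume n: "n \<in> {N-k..<N}"
        have "\<psi> n \<le> \<psi> N" using n by (intro mono) auto
        moreover have "real n \<ge> real N - e * real N / 2" using n k(1) kN by auto
        ultimately have 1: "real n - \<psi> n \<ge> e * real N / 2" using * by linarith
        have "real n ^ 2 \<le> real N ^ 2" using n by (intro power_mono) auto
        hence 2: "real n ^ 2 \<le> 4 * real N ^ 2" using zero_le_power2[of "real N"] by linarith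
        have n0: "n > 0" using n N kN by (cases "n = 0") auto
        have 3: "0 \<le> e * real N / 2" and 4: "0 < real n ^ 2" using e n0 by simp_all
        have "e / (8 * real N) = (e * real N / 2) / (4 * real N ^ 2)"
          using N by (simp add: power2_eq_square)
        also have "\<dots> \<le> (real n - \<psi> n) / real n ^ 2"
          by (rule frac_le[OF order.trans[OF 3 1] 1 4 2])
        also have "\<dots> = - g n" by (simp add: g_def minus_divide_left)
        finally show "e / (8 * real N) \<le> - g n" .
      qed
      also have "\<dots> \<le> norm (sum g {N-k..<N})" by (simp add: sum_negf)
      also have "\<dots> < e ^ 2 / 32" using N kN by (intro M) auto
      finally show False by simp
    qed
    ultimately show ?case using e by (simp add: dist_real_def abs_less_iff)
  qed
qed

section \<open>Summation by parts and the correction series\<close>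

lemma dirichlet_abel_summation:
  fixes a u :: "nat \<Rightarrow> 'a :: comm_ring_1"
  shows "(\<Sum>n\<le>M. (\<Sum>k\<le>n. a k) * (u n - u (Suc n))) = (\<Sum>n\<le>M. a n * u n) - (\<Sum>k\<le>M. a k) * u (Suc M)"
  by (induction M) (simp_all add: algebra_simps)

definition psi_coeff :: "nat \<Rightarrow> complex" where
  "psi_coeff n = of_real ((chebyshev_psi n - real n) / real n)"

lemma psi_coeff_mult: "of_nat n * psi_coeff n = of_real (chebyshev_psi n - real n)"
  by (cases "n = 0") (simp_all add: psi_coeff_def)

lemma norm_psi_coeff_le: "norm (psi_coeff n) \<le> 4"
proof (cases "n = 0")
  case False
  have "\<bar>chebyshev_psi n - real n\<bar> \<le> 4 * real n"
    using chebyshev_psi_le[of n] chebyshev_psi_nonneg[of n] by (simp add: abs_le_iff)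
  hence "\<bar>chebyshev_psi n - real n\<bar> / real n \<le> 4" using False by (simp add: pos_divide_le_eq)
  thus ?thesis by (simp only: psi_coeff_def norm_of_real abs_divide abs_of_nat)
qed (simp add: psi_coeff_def)

text \<open>Chebyshev's bound makes the boundary term of the summation by parts O(M powr (1 - Re
  s)), which vanishes in the limit.\<close>

lemma psi_minus_id_sums:
  assumes s: "Re s > 1"
  shows "(\<lambda>n. of_real (chebyshev_psi n - real n) * (npow n s - npow (Suc n) s)) sums
           (mangoldt_series s - zeta_series s)"
proof -
  \<comment> \<open>The exception at 0 makes the partial sums exactly \<psi>(n) - n; the series is
    unaffected because \<open>npow 0 s\<close> is 0.\<close>
  define a :: "nat \<Rightarrow> complex" where "a = (\<lambda>n. mangoldt n - (if n = 0 then 0 else 1))"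
  have sum_a: "(\<Sum>k\<le>n. a k) = of_real (chebyshev_psi n - real n)" for n
    by (induction n) (simp_all add: a_def chebyshev_psi_Suc)
  have "(\<lambda>n. mangoldt n * npow n s - npow n s) sums (mangoldt_series s - zeta_series s)"
    using s by (intro sums_diff mangoldt_series_sums zeta_series_sums)
  moreover have "mangoldt n * npow n s - npow n s = a n * npow n s" for n
    by (simp add: a_def algebra_simps)
  ultimately have 1: "(\<lambda>M. \<Sum>n\<le>M. a n * npow n s) \<longlonglongrightarrow> mangoldt_series s - zeta_series s"
    by (simp add: sums_def_le)
  have 2: "(\<lambda>M. (\<Sum>k\<le>M. a k) * npow (Suc M) s) \<longlonglongrightarrow> 0"
  proof (rule Lim_null_comparison)
    have "(\<lambda>M. real M powr (1 - Re s)) \<longlonglongrightarrow> 0"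
      using s by (intro tendsto_neg_powr filterlim_real_sequentially) auto
    from tendsto_mult_right_zero[OF LIMSEQ_Suc[OF this], of 4]
    show "(\<lambda>M. 4 * real (Suc M) powr (1 - Re s)) \<longlonglongrightarrow> 0" .
    show "\<forall>\<^sub>F M in sequentially. norm ((\<Sum>k\<le>M. a k) * npow (Suc M) s) \<le> 4 * real (Suc M) powr (1 - Re s)"
    proof (intro always_eventually allI)
      fix M
      have "norm ((\<Sum>k\<le>M. a k) * npow (Suc M) s) = \<bar>chebyshev_psi M - real M\<bar> * real (Suc M) powr (- Re s)"
        by (simp only: sum_a norm_mult norm_npow norm_of_real)
      also have "\<dots> \<le> (4 * real (Suc M)) * real (Suc M) powr (- Re s)"
        using chebyshev_psi_le[of M] chebyshev_psi_nonneg[of M]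
        by (intro mult_right_mono) (auto simp: abs_le_iff)
      also have "real (Suc M) powr (1 - Re s) = real (Suc M) powr 1 * real (Suc M) powr (- Re s)"
        by (subst powr_add [symmetric]) simp
      hence "(4 * real (Suc M)) * real (Suc M) powr (- Re s) = 4 * real (Suc M) powr (1 - Re s)"
        by (simp only: powr_one_gt_zero_iff) simp
      finally show "norm ((\<Sum>k\<le>M. a k) * npow (Suc M) s) \<le> 4 * real (Suc M) powr (1 - Re s)" .
    qed
  qed
  have "(\<lambda>M. \<Sum>n\<le>M. (\<Sum>k\<le>n. a k) * (npow n s - npow (Suc n) s)) \<longlonglongrightarrow> mangoldt_series s - zeta_series s"
    using tendsto_diff[OF 1 2] by (simp only: dirichlet_abel_summation[of a "\<lambda>n. npow n s"] diff_0_right)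
  thus ?thesis unfolding sum_a sums_def_le .
qed

text \<open>
  Summation by parts produces the weights \<open>n (n powr (-s) - (n + 1) powr (-s))\<close>, which agree with
  \<open>s * n powr (-s)\<close> up to an extra factor of order \<open>1/n\<close>.
\<close>
definition abel_correction :: "nat \<Rightarrow> complex \<Rightarrow> complex" where
  "abel_correction n s = psi_coeff n * (of_nat n * (npow n s - npow (Suc n) s) - s * npow n s)"

text \<open>The weight is -n times the Taylor remainder of x powr (-s) at n, so n powr (-Re s - 2)
  loses one power of n. The exponent is written \<open>0 - 1 - Re s\<close> to match the half-plane
  criterion with a = 0.\<close>

lemma norm_abel_correction_le:
  assumes n: "n > 0" and s: "Re s > 0"
  shows "norm (abel_correction n s) \<le> 4 * (norm s * norm (s + 1)) * real n powr (0 - 1 - Re s)"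
proof -
  have "of_nat n * of_nat n powr (- s - 1) = npow n s"
    using n by (simp add: powr_diff powr_minus field_simps)
  hence eq: "of_nat n * (npow n s - npow (Suc n) s) - s * npow n s =
        - (of_nat n * (npow (Suc n) s - npow n s - (- s) * of_nat n powr (- s - 1)))"
    by (simp add: algebra_simps)
  have "norm (of_nat n * (npow n s - npow (Suc n) s) - s * npow n s) \<le>
          real n * (norm s * norm (s + 1) * real n powr (- Re s - 2))"
    unfolding eq norm_minus_cancel norm_mult
    using norm_powr_Suc_diff_le[of n "-s"] n s norm_minus_cancel[of "s + 1"]
    by (intro mult_mono) (simp_all add: norm_mult)
  also have "\<dots> = (norm s * norm (s + 1)) * (real n powr 1 * real n powr (- Re s - 2))"
    using n by simp
  also have "real n powr 1 * real n powr (- Re s - 2) = real n powr (0 - 1 - Re s)"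
    by (subst powr_add [symmetric]) (rule arg_cong[where f = "(powr) (real n)"], simp)
  finally have "norm (abel_correction n s) \<le> 4 * ((norm s * norm (s + 1)) * real n powr (0 - 1 - Re s))"
    unfolding abel_correction_def norm_mult
    using norm_psi_coeff_le[of n] by (intro mult_mono) auto
  thus ?thesis by (simp only: mult.assoc)
qed

lemma abel_correction_series:
  "(\<lambda>s. \<Sum>n. abel_correction n s) holomorphic_on {s. Re s > 0}"
  "Re s > 0 \<Longrightarrow> summable (\<lambda>n. abel_correction n s)"
proof -
  have hol: "abel_correction n holomorphic_on {s. Re s > 0}" for n
    unfolding abel_correction_def [abs_def] by (intro holomorphic_intros)
  have cont: "continuous (at s) (\<lambda>s. 4 * (norm s * norm (s + 1)))" for s :: complex
    by (intro continuous_intros)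
  note * = holomorphic_series_halfplane[OF hol cont norm_abel_correction_le]
  show "(\<lambda>s. \<Sum>n. abel_correction n s) holomorphic_on {s. Re s > 0}"
    "Re s > 0 \<Longrightarrow> summable (\<lambda>n. abel_correction n s)" using *(1,2) by auto
qed

lemma summable_psi_minus_id: "summable (\<lambda>n. (chebyshev_psi n - real n) / real n ^ 2)"
proof -
  define W where "W = (\<lambda>s. \<Sum>n. abel_correction n s)"
  \<comment> \<open>Obtained by solving for the series: with s = 1 + z, the summation by parts reads
    M(s) = s P(s) + W(s), where M is \<open>mangoldt_minus_zeta\<close> and P is the Dirichlet
    series of \<open>psi_coeff\<close>. The divisor 1 + z has no zero on Re z \<ge> 0.\<close>
  define f where "f = (\<lambda>z. (mangoldt_minus_zeta (1 + z) - W (1 + z)) / (1 + z))"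
  have W: "W analytic_on {s. Re s \<ge> 1}"
    unfolding W_def using abel_correction_series(1) open_halfspace_Re_gt[of 0]
    by (auto simp: analytic_on_holomorphic)
  have shift: "(\<lambda>z. 1 + z) analytic_on {z :: complex. Re z \<ge> 0}" by (intro analytic_intros)
  have "(\<lambda>z. W (1 + z)) analytic_on {z. Re z \<ge> 0}"
    using analytic_on_compose_gen[OF shift W] by (simp add: o_def)
  moreover have "(\<lambda>z. mangoldt_minus_zeta (1 + z)) analytic_on {z. Re z \<ge> 0}"
    using analytic_on_compose_gen[OF shift analytic_mangoldt_minus_zeta] by (simp add: o_def)
  ultimately have f: "f analytic_on {z. Re z \<ge> 0}"
    unfolding f_def by (intro analytic_intros) (auto simp: complex_eq_iff)
  have "(\<lambda>n. psi_coeff n * of_nat n powr (-1 - z)) sums f z" if z: "Re z > 0" for z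
  proof -
    define s where "s = 1 + z"
    have s: "Re s > 1" "s \<noteq> 0" using z by (auto simp: s_def complex_eq_iff)
    have "(\<lambda>n. abel_correction n s) sums W s"
      unfolding W_def using abel_correction_series(2)[of s] s by (simp add: summable_sums)
    from sums_diff[OF psi_minus_id_sums[OF s(1)] this]
    have "(\<lambda>n. of_real (chebyshev_psi n - real n) * (npow n s - npow (Suc n) s) - abel_correction n s)
            sums (mangoldt_minus_zeta s - W s)" by (simp only: mangoldt_minus_zeta_eq[OF s(1)])
    moreover have "of_real (chebyshev_psi n - real n) * (npow n s - npow (Suc n) s) - abel_correction n s
                     = s * (psi_coeff n * npow n s)" for n
      unfolding abel_correction_def psi_coeff_mult [symmetric] by (simp add: algebra_simps)
    ultimately have "(\<lambda>n. s * (psi_coeff n * npow n s)) sums (mangoldt_minus_zeta s - W s)" by (simp only:)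
    from sums_divide[OF this, of s] have "(\<lambda>n. psi_coeff n * npow n s) sums f z"
      using s(2) by (simp add: f_def s_def)
    moreover have "- s = -1 - z" by (simp add: s_def)
    ultimately show ?thesis by (simp only:)
  qed
  from newman_dirichlet_series[OF norm_psi_coeff_le f this]
  have "summable (\<lambda>n. psi_coeff n / of_nat n)" by (rule sums_summable)
  hence "summable (\<lambda>n. Re (psi_coeff n / of_nat n))" by (rule summable_Re)
  moreover have "Re (psi_coeff n / of_nat n) = (chebyshev_psi n - real n) / real n ^ 2" for n
  proof -
    have "psi_coeff n / of_nat n = of_real ((chebyshev_psi n - real n) / real n ^ 2)"
      by (simp add: psi_coeff_def power2_eq_square)
    thus ?thesis by (simp only: Re_complex_of_real)
  qed
  ultimately show ?thesis by simp
qed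

theorem chebyshev_psi_asymptotics: "(\<lambda>n. chebyshev_psi n / real n) \<longlonglongrightarrow> 1"
  by (rule tendsto_one_if_summable_psi[OF chebyshev_psi_mono summable_psi_minus_id])

section \<open>From the Chebyshev function to the prime-counting function\<close>

lemma finite_primes_le: "finite {p :: nat. prime p \<and> real p \<le> x}"
  by (rule finite_subset[of _ "{..nat \<lfloor>x\<rfloor>}"]) (auto simp: le_nat_iff le_floor_iff)

text \<open>Grouping prime powers by their prime: at most ln x / ln p powers of p are \<le> x, each
  with weight ln p, so every prime contributes at most ln x.\<close>

lemma chebyshev_psi_le_prime_count:
  assumes x: "x \<ge> 1"
  shows "chebyshev_psi (nat \<lfloor>x\<rfloor>) \<le> real (prime_count x) * ln x"
proof -
  define P where "P = {p :: nat. prime p \<and> real p \<le> x}"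
  define Q where "Q = {q \<in> {..nat \<lfloor>x\<rfloor>}. primepow q}"
  have le_x: "real n \<le> x" if "n \<le> nat \<lfloor>x\<rfloor>" for n
    using that x by (simp add: le_nat_iff le_floor_iff)
  have finP: "finite P" unfolding P_def by (rule finite_primes_le)
  have img: "aprimedivisor ` Q \<subseteq> P"
  proof (intro subsetI)
    fix p assume "p \<in> aprimedivisor ` Q"
    then obtain q where q: "q \<in> Q" "p = aprimedivisor q" by blast
    hence "q > 1" using primepow_gt_Suc_0[of q] by (simp add: Q_def)
    hence "prime p" "p \<le> q"
      using q by (auto intro!: prime_aprimedivisor' aprimedivisor_le_nat)
    moreover have "real q \<le> x" using q le_x by (simp add: Q_def)
    ultimately show "p \<in> P" by (simp add: P_def)
  qed
  have "chebyshev_psi (nat \<lfloor>x\<rfloor>) = (\<Sum>q\<in>Q. mangoldt q)"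
    unfolding chebyshev_psi_def Q_def
    by (intro sum.mono_neutral_right) (auto simp: mangoldt_def)
  also have "\<dots> = (\<Sum>q\<in>Q. ln (real (aprimedivisor q)))"
    by (intro sum.cong) (auto simp: Q_def mangoldt_def)
  also have "\<dots> = (\<Sum>p\<in>P. \<Sum>q\<in>{q\<in>Q. aprimedivisor q = p}. ln (real (aprimedivisor q)))"
    by (rule sum.group [symmetric]) (use finP img in \<open>auto simp: Q_def\<close>)
  also have "\<dots> \<le> (\<Sum>p\<in>P. ln x)"
  proof (rule sum_mono)
    fix p assume p: "p \<in> P"
    hence p1: "p > 1" "prime p" by (auto simp: P_def dest: prime_gt_1_nat)
    have lnp: "ln (real p) > 0" using p1 by simp
    define K where "K = nat \<lfloor>ln x / ln (real p)\<rfloor>"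
    have lnx: "ln x \<ge> 0" using x by simp
    have "{q\<in>Q. aprimedivisor q = p} \<subseteq> (\<lambda>k. p ^ k) ` {1..K}"
    proof (intro subsetI)
      fix q assume q: "q \<in> {q\<in>Q. aprimedivisor q = p}"
      then obtain k where k: "k > 0" "q = p ^ k"
        by (auto simp: Q_def primepow_def aprimedivisor_prime_power)
      have "real p ^ k \<le> x" using q le_x[of q] k by (simp add: Q_def)
      hence "ln (real p ^ k) \<le> ln x" using p1 x by (subst ln_le_cancel_iff) auto
      hence "real k * ln (real p) \<le> ln x" using p1 by (simp add: ln_realpow)
      hence "real k \<le> ln x / ln (real p)" using lnp by (simp add: pos_le_divide_eq)
      hence "k \<le> K" unfolding K_def by linarith
      thus "q \<in> (\<lambda>k. p ^ k) ` {1..K}" using k by auto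
    qed
    from surj_card_le[OF _ this] have card: "card {q\<in>Q. aprimedivisor q = p} \<le> K" by simp
    have "(\<Sum>q\<in>{q\<in>Q. aprimedivisor q = p}. ln (real (aprimedivisor q)))
            = real (card {q\<in>Q. aprimedivisor q = p}) * ln (real p)" by simp
    also have "\<dots> \<le> real K * ln (real p)" using card lnp by (intro mult_right_mono) auto
    also have "\<dots> \<le> ln x / ln (real p) * ln (real p)"
      using lnp lnx by (intro mult_right_mono) (auto simp: K_def)
    also have "\<dots> = ln x" using lnp by simp
    finally show "(\<Sum>q\<in>{q\<in>Q. aprimedivisor q = p}. ln (real (aprimedivisor q))) \<le> ln x" .
  qed
  also have "\<dots> = real (prime_count x) * ln x" by (simp add: P_def prime_count_def)
  finally show ?thesis .
qed

text \<open>Primes up to y are counted trivially; each prime between y and x adds at least ln y to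
  \<psi>.\<close>

lemma prime_count_le_chebyshev_psi:
  assumes y: "1 < y" "y \<le> x"
  shows "real (prime_count x) \<le> y + chebyshev_psi (nat \<lfloor>x\<rfloor>) / ln y"
proof -
  define P where "P = {p :: nat. prime p \<and> real p \<le> x}"
  define A where "A = {p \<in> P. real p \<le> y}"
  define B where "B = {p \<in> P. real p > y}"
  have fin: "finite A" "finite B" by (auto simp: A_def B_def P_def intro!: finite_subset[OF _ finite_primes_le[of x]])
  have "A \<subseteq> {1..nat \<lfloor>y\<rfloor>}"
    using y by (auto simp: A_def P_def le_nat_iff le_floor_iff Suc_le_eq prime_gt_0_nat)
  from card_mono[OF _ this] have "card A \<le> nat \<lfloor>y\<rfloor>" by simp
  hence A: "real (card A) \<le> y" using y by linarith
  have "real (card B) * ln y = (\<Sum>p\<in>B. ln y)" by simp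
  also have "\<dots> \<le> (\<Sum>p\<in>B. mangoldt p)"
  proof (rule sum_mono)
    fix p assume "p \<in> B"
    thus "ln y \<le> mangoldt p" using y by (auto simp: B_def P_def)
  qed
  also have "\<dots> \<le> chebyshev_psi (nat \<lfloor>x\<rfloor>)"
    unfolding chebyshev_psi_def
    by (intro sum_mono2) (auto simp: B_def P_def mangoldt_nonneg le_nat_iff le_floor_iff)
  finally have B: "real (card B) \<le> chebyshev_psi (nat \<lfloor>x\<rfloor>) / ln y"
    using y by (simp add: pos_le_divide_eq)
  have "P = A \<union> B" by (auto simp: A_def B_def)
  hence "prime_count x = card (A \<union> B)" by (simp add: prime_count_def P_def)
  also have "\<dots> \<le> card A + card B" by (rule card_Un_le)
  finally show ?thesis using A B by linarith
qed

lemma chebyshev_psi_floor_asymptotics: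
  "((\<lambda>x. chebyshev_psi (nat \<lfloor>x\<rfloor>) / x) \<longlongrightarrow> 1) at_top"
proof -
  have "filterlim (\<lambda>x::real. nat \<lfloor>x\<rfloor>) sequentially at_top"
    by (intro filterlim_compose[OF filterlim_nat_sequentially] filterlim_floor_sequentially)
  from filterlim_compose[OF chebyshev_psi_asymptotics this]
  have 1: "((\<lambda>x::real. chebyshev_psi (nat \<lfloor>x\<rfloor>) / real (nat \<lfloor>x\<rfloor>)) \<longlongrightarrow> 1) at_top" .
  have "((\<lambda>x::real. of_int \<lfloor>x\<rfloor> / x) \<longlongrightarrow> 1) at_top" by real_asymp
  from tendsto_mult[OF 1 this]
  have "((\<lambda>x. chebyshev_psi (nat \<lfloor>x\<rfloor>) / real (nat \<lfloor>x\<rfloor>) * (of_int \<lfloor>x\<rfloor> / x)) \<longlongrightarrow> 1) at_top" by simp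
  thus ?thesis
  proof (rule Lim_transform_eventually)
    show "\<forall>\<^sub>F x in at_top. chebyshev_psi (nat \<lfloor>x\<rfloor>) / real (nat \<lfloor>x\<rfloor>) * (of_int \<lfloor>x\<rfloor> / x)
            = chebyshev_psi (nat \<lfloor>x\<rfloor>) / x"
      using eventually_ge_at_top[of 1]
    proof eventually_elim
      case (elim x)
      hence "\<lfloor>x\<rfloor> \<ge> 1" by (simp only: one_le_floor)
      hence "real_of_int \<lfloor>x\<rfloor> \<noteq> 0" by linarith
      moreover have "real (nat \<lfloor>x\<rfloor>) = of_int \<lfloor>x\<rfloor>" using elim by simp
      ultimately show ?case by simp
    qed
  qed
qed

text \<open>The upper bound cuts at y = x / ln x ^ 2: this is negligible against x / ln x, while ln
  y is still asymptotic to ln x.\<close>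

theorem prime_number_theorem_ratio:
  "((\<lambda>x :: real. real (prime_count x) * ln x / x) \<longlongrightarrow> 1) at_top"
proof (rule tendsto_sandwich)
  show "((\<lambda>x. chebyshev_psi (nat \<lfloor>x\<rfloor>) / x) \<longlongrightarrow> 1) at_top"
    by (rule chebyshev_psi_floor_asymptotics)
  show "\<forall>\<^sub>F x in at_top. chebyshev_psi (nat \<lfloor>x\<rfloor>) / x \<le> real (prime_count x) * ln x / x"
    using eventually_ge_at_top[of 1]
    by eventually_elim (intro divide_right_mono chebyshev_psi_le_prime_count, auto)
  have "((\<lambda>x::real. 1 / ln x) \<longlongrightarrow> 0) at_top" "((\<lambda>x::real. ln x / ln (x / ln x ^ 2)) \<longlongrightarrow> 1) at_top"
    by real_asymp+
  from tendsto_add[OF this(1) tendsto_mult[OF chebyshev_psi_floor_asymptotics this(2)]]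
  show "((\<lambda>x. 1 / ln x + chebyshev_psi (nat \<lfloor>x\<rfloor>) / x * (ln x / ln (x / ln x ^ 2))) \<longlongrightarrow> 1) at_top"
    by simp
  have "eventually (\<lambda>x::real. 1 < x / ln x ^ 2) at_top" "eventually (\<lambda>x::real. x / ln x ^ 2 \<le> x) at_top"
    by real_asymp+
  thus "\<forall>\<^sub>F x in at_top. real (prime_count x) * ln x / x
          \<le> 1 / ln x + chebyshev_psi (nat \<lfloor>x\<rfloor>) / x * (ln x / ln (x / ln x ^ 2))"
    using eventually_gt_at_top[of 1]
  proof eventually_elim
    case (elim x)
    define \<psi> y where "\<psi> = chebyshev_psi (nat \<lfloor>x\<rfloor>)" and "y = x / ln x ^ 2"
    have lnx: "ln x > 0" using elim by simp
    have "real (prime_count x) * (ln x / x) \<le> (y + \<psi> / ln y) * (ln x / x)"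
      unfolding \<psi>_def y_def using elim lnx by (intro mult_right_mono prime_count_le_chebyshev_psi) auto
    also have "\<dots> = y * (ln x / x) + \<psi> / ln y * (ln x / x)" by (rule distrib_right)
    also have "\<psi> / ln y * (ln x / x) = \<psi> / x * (ln x / ln y)" by simp
    also have "y * (ln x / x) = 1 / ln x" using lnx elim by (simp add: y_def power2_eq_square)
    finally show ?case by (simp add: \<psi>_def y_def)
  qed
qed

theorem theorem2p8:
  shows "asymp_equiv (\<lambda>x :: real. real (prime_count x)) at_top (\<lambda>x. x / ln x)
       \<and> ((\<lambda>x :: real. real (prime_count x) * ln x / x) \<longlongrightarrow> 1) at_top"
proof
  show "asymp_equiv (\<lambda>x :: real. real (prime_count x)) at_top (\<lambda>x. x / ln x)"
  proof (rule asymp_equivI')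
    show "((\<lambda>x. real (prime_count x) / (x / ln x)) \<longlongrightarrow> 1) at_top"
      using prime_number_theorem_ratio by simp
  qed
qed (rule prime_number_theorem_ratio)

end
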